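(* Let $k$ be a positive integer. For any nonnegative integer $N$, $$\mathcal{Z}_k(N;t,q)=\frac{(1-t)^2\,q^N\,(t^{2N}q^{N^2})^{k-1}}{(1-tq^N)^2}\,\mathcal{Z}_k(N;t^{-1}q^{-N},q).$$
   Context: $q,t$ are generic nonzero (formal) parameters for which no denominator vanishes. For $n\in\mathbb{N}$, $(A;q)_n:=\prod_{j=0}^{n-1}(1-Aq^j)$; $1/(q;q)_n:=0$ for integers $n<0$. The $q$-binomial coefficient is $\begin{bmatrix}N\\ M\end{bmatrix}_q:=\frac{(q;q)_N}{(q;q)_M(q;q)_{N-M}}$ if $0\le M\le N$, and $0$ otherwise. Empty products equal $1$. For a positive integer $k$ and a nonnegative integer $N$, with $s_0:=0$, $$\mathcal{Z}_k(N;t,q):=\sum_{\substack{r_k\ge\cdots\ge r_1\ge0\\ s_k\ge\cdots\ge s_1\ge0}}\frac{t^{\sum_{i=1}^k(2r_i-s_i)}q^{\sum_{i=1}^k(r_i^2-r_is_i+s_i^2)}}{(q;q)_{N-r_k}\,(q;q)_{r_k-r_{k-1}}\cdots(q;q)_{r_2-r_1}\,(tq;q)_{r_1}^2\,(q;q)_{s_1}}\prod_{i=1}^k\begin{bmatrix}r_i-s_{i-1}\\ r_i-s_i\end{bmatrix}_q,$$ a finite sum. *)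

theory Defs
  imports Complex_Main "HOL-Library.FuncSet"
begin

definition qpoch :: "'a::field \<Rightarrow> 'a \<Rightarrow> nat \<Rightarrow> 'a" where
  "qpoch A q n = (\<Prod>j<n. 1 - A * q ^ j)"

text \<open>The reciprocal of \<open>(q;q)\<^sub>n\<close> for an integer \<open>n\<close>, with the convention that it is 0 for \<open>n < 0\<close>.\<close>

definition inv_qfact :: "'a::field \<Rightarrow> int \<Rightarrow> 'a" where
  "inv_qfact q n = (if n < 0 then 0 else 1 / qpoch q q (nat n))"

definition qbinom :: "'a::field \<Rightarrow> int \<Rightarrow> int \<Rightarrow> 'a" where
  "qbinom q N M =
    (if 0 \<le> M \<and> M \<le> N
     then qpoch q q (nat N) / (qpoch q q (nat M) * qpoch q q (nat (N - M)))
     else 0)"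

text \<open>
  Tuples \<open>x\<^sub>k \<ge> \<dots> \<ge> x\<^sub>1 \<ge> 0\<close>, as functions on \<open>{1..k}\<close> that are \<open>undefined\<close> elsewhere, so that
  each tuple is represented exactly once.
\<close>

definition chains :: "nat \<Rightarrow> (nat \<Rightarrow> nat) set" where
  "chains k = {x \<in> {1..k} \<rightarrow>\<^sub>E UNIV. mono_on {1..k} x}"

text \<open>
  The summand. All index arithmetic is done in the integers, and the update \<open>s(0 := 0)\<close>
  is the convention \<open>s\<^sub>0 = 0\<close>.
\<close>

definition Z_term :: "nat \<Rightarrow> nat \<Rightarrow> 'a::field \<Rightarrow> 'a \<Rightarrow> (nat \<Rightarrow> nat) \<Rightarrow> (nat \<Rightarrow> nat) \<Rightarrow> 'a" where
  "Z_term k N t q r s =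
    t powi (\<Sum>i=1..k. 2 * int (r i) - int (s i)) *
    q powi (\<Sum>i=1..k. (int (r i))\<^sup>2 - int (r i) * int (s i) + (int (s i))\<^sup>2) *
    inv_qfact q (int N - int (r k)) *
    (\<Prod>i=2..k. inv_qfact q (int (r i) - int (r (i - 1)))) /
    ((qpoch (t * q) q (r 1))\<^sup>2 * qpoch q q (s 1)) *
    (\<Prod>i=1..k. qbinom q (int (r i) - int ((s(0 := 0)) (i - 1))) (int (r i) - int (s i)))"

text \<open>
  The sum over all pairs of tuples has only finitely many nonzero terms; they all satisfy
  \<open>r\<^sub>k \<le> N\<close> and \<open>s\<^sub>k \<le> N\<close> (lemma \<open>Z_term_eq_0\<close> below), and the sum is taken over this finite range.
\<close>

definition Z_sum :: "nat \<Rightarrow> nat \<Rightarrow> 'a::field \<Rightarrow> 'a \<Rightarrow> 'a" where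
  "Z_sum k N t q =
    (\<Sum>(r, s) \<in> {x \<in> chains k. x k \<le> N} \<times> {x \<in> chains k. x k \<le> N}. Z_term k N t q r s)"

lemma Z_term_eq_0:
  assumes "k \<ge> 1" and "r k > N \<or> s k > N"
  shows "Z_term k N t q r s = 0"
proof (cases "r k > N")
  case True
  then show ?thesis by (simp add: Z_term_def inv_qfact_def)
next
  case False
  with assms have "s k > r k" by auto
  then have "qbinom q (int (r k) - int ((s(0 := 0)) (k - 1))) (int (r k) - int (s k)) = 0"
    by (simp add: qbinom_def)
  with assms(1) have
    "(\<Prod>i=1..k. qbinom q (int (r i) - int ((s(0 := 0)) (i - 1))) (int (r i) - int (s i))) = 0"
    by (intro prod_zero finite_atLeastAtMost bexI[of _ k]) simp_all
  then show ?thesis by (simp add: Z_term_def)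
qed

lemma finite_bounded_chains:
  assumes "k \<ge> 1"
  shows "finite {x \<in> chains k. x k \<le> N}"
proof (rule finite_subset)
  show "{x \<in> chains k. x k \<le> N} \<subseteq> {1..k} \<rightarrow>\<^sub>E {..N}"
  proof
    fix x assume x: "x \<in> {x \<in> chains k. x k \<le> N}"
    have "x i \<le> N" if "i \<in> {1..k}" for i
    proof -
      have "x i \<le> x k"
        using x that assms by (auto simp: chains_def mono_on_def)
      with x show ?thesis by auto
    qed
    with x show "x \<in> {1..k} \<rightarrow>\<^sub>E {..N}"
      by (auto simp: chains_def PiE_iff)
  qed
  show "finite ({1..k} \<rightarrow>\<^sub>E {..N})"
    by (intro finite_PiE) auto
qed

end

theory Submission
  imports Defs "HOL-Computational_Algebra.Polynomial"
begin

text \<open>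
  The identity already holds for each fixed chain \<open>s\<close>, after summing over \<open>r\<close> only. The inner sum is
  built up one index at a time and is kept in the form of a very-well-poised sum
  \<open>\<Sum>\<^sub>i (-1)\<^sup>i q\<^bsup>i(i-1)/2\<^esup> (1 - A q\<^bsup>2i\<^esup>) g\<^sub>i / ((q;q)\<^sub>i (q;q)\<^bsub>n-i\<^esub> (A q\<^sup>i;q)\<^bsub>n+1\<^esub>)\<close>
  with \<open>A = t\<^sup>2 q\<^bsup>s\<^esup>\<close>, \<open>s = s\<^sub>k\<close> and \<open>n = N - s\<close>. The starting value \<open>1/(tq;q)\<^sub>r\<^sup>2\<close> is such a sum with
  \<open>g\<^sub>i\<close> proportional to \<open>q\<^sup>i/(1 - t q\<^sup>i)\<^sup>2\<close>; the factor \<open>(q;q)\<^bsub>r-a\<^esub>/(q;q)\<^bsub>r-b\<^esub>\<close> moves \<open>A\<close> to \<open>A q\<^bsup>b-a\<^esup>\<close>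
  (a Bailey lattice step), and the weighted sum over \<open>r\<close> multiplies \<open>g\<^sub>i\<close> by \<open>A\<^sup>i q\<^bsup>i*i\<^esup>\<close> (the Bailey lemma).
  Replacing \<open>t\<close> by \<open>1/(t q\<^sup>N)\<close> replaces \<open>A\<close> by \<open>1/(A q\<^bsup>2n\<^esup>)\<close>. This reverses the order of summation of
  a very-well-poised sum, and each step preserves the property that it reverses \<open>g\<close>
  up to a constant factor.

  The intermediate sums have poles where \<open>t\<^sup>2 q\<^sup>m = 1\<close>. They are absent from the two sides of the
  identity, which therefore extends to these \<open>t\<close> because both sides are rational functions of \<open>t\<close>.
\<close>

section \<open>q-shifted factorials and a limiting q-Vandermonde sum\<close>

lemma qpoch_0 [simp]: "qpoch A q 0 = 1"
  by (simp add: qpoch_def)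

lemma qpoch_Suc: "qpoch A q (Suc n) = qpoch A q n * (1 - A * q ^ n)"
  by (simp add: qpoch_def)

lemma qpoch_q_Suc: "qpoch q q (Suc n) = qpoch q q n * (1 - q ^ Suc n)"
  by (simp add: qpoch_Suc)

lemma qpoch_Suc_shift: "qpoch A q (Suc n) = (1 - A) * qpoch (A * q) q n"
  unfolding qpoch_def by (subst prod.lessThan_Suc_shift) (simp add: mult.assoc)

lemma qpoch_add: "qpoch A q (m + n) = qpoch A q m * qpoch (A * q ^ m) q n"
  by (induction n) (simp_all add: qpoch_Suc power_add mult.assoc)

lemma qpoch_eq_0_iff: "qpoch A q n = 0 \<longleftrightarrow> (\<exists>j<n. A * q ^ j = 1)"
  by (auto simp: qpoch_def)

lemma qpoch_q_nonzero:
  assumes "\<And>j. 1 \<le> j \<Longrightarrow> j \<le> n \<Longrightarrow> q ^ j \<noteq> 1" and "m \<le> n"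
  shows "qpoch q q m \<noteq> 0"
  using assms(1)[of "Suc j" for j] assms(2) by (auto simp: qpoch_eq_0_iff)

lemma choose_two_0: "(0::nat) choose 2 = 0"
  by simp

lemma choose_two_Suc: "Suc n choose 2 = n + (n choose 2)"
  by (simp add: numeral_2_eq_2)

text \<open>The limit of the q-Chu-Vandermonde sum in which one numerator parameter tends to
  infinity. Induction on \<open>n\<close> with \<open>B\<close> free: splitting
  \<open>1 - q ^ Suc n\<close> reduces the sum to the case \<open>n\<close> at \<open>B\<close> and
  at \<open>B * q\<close>.\<close>

lemma q_vandermonde:
  fixes q B :: "'a::field"
  assumes "\<And>j. 1 \<le> j \<Longrightarrow> j \<le> n \<Longrightarrow> q ^ j \<noteq> 1"
    and "\<And>j. 1 \<le> j \<Longrightarrow> j \<le> n \<Longrightarrow> B * q ^ j \<noteq> 1"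
  shows "(\<Sum>m\<le>n. B ^ m * q ^ m\<^sup>2 / (qpoch q q m * qpoch q q (n - m) * qpoch (B * q) q m)) =
    1 / (qpoch q q n * qpoch (B * q) q n)"
  using assms
proof (induction n arbitrary: B)
  case 0
  then show ?case by simp
next
  case (Suc n)
  define X where "X = (\<lambda>m. B ^ m * q ^ m\<^sup>2 / (qpoch q q m * qpoch q q (Suc n - m) * qpoch (B * q) q m))"
  have nz: "1 - q ^ Suc n \<noteq> 0" using Suc.prems(1)[of "Suc n"] by simp
  have nzBn: "1 - B * q ^ Suc n \<noteq> 0" using Suc.prems(2)[of "Suc n"] by simp
  have qnz: "qpoch q q m \<noteq> 0" if "m \<le> Suc n" for m
    using Suc.prems(1) that by (rule qpoch_q_nonzero)
  have nzP: "qpoch (B * q) q n \<noteq> 0"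
    using Suc.prems(2)[of "Suc j" for j] by (auto simp: qpoch_eq_0_iff mult.assoc)
  have IH1: "(\<Sum>m\<le>n. B ^ m * q ^ m\<^sup>2 / (qpoch q q m * qpoch q q (n - m) * qpoch (B * q) q m)) =
    1 / (qpoch q q n * qpoch (B * q) q n)"
    using Suc.prems by (intro Suc.IH) auto
  have IH2: "(\<Sum>m\<le>n. (B * q) ^ m * q ^ m\<^sup>2 / (qpoch q q m * qpoch q q (n - m) * qpoch (B * q * q) q m)) =
    1 / (qpoch q q n * qpoch (B * q * q) q n)"
    using Suc.prems(1) Suc.prems(2)[of "Suc j" for j] by (intro Suc.IH) (auto simp: mult.assoc)
  have "(1 - q ^ Suc n) * (\<Sum>m\<le>Suc n. X m) =
      (\<Sum>m\<le>Suc n. (1 - q ^ (Suc n - m)) * X m + q ^ (Suc n - m) * (1 - q ^ m) * X m)"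
  proof (unfold sum_distrib_left, intro sum.cong refl) \<comment> \<open>Pascal's rule for \<open>q\<close>-binomials\<close>
    fix m assume "m \<in> {..Suc n}"
    then have "q ^ (Suc n - m) * q ^ m = q ^ Suc n"
      by (subst power_add[symmetric]) simp
    then show "(1 - q ^ Suc n) * X m =
      (1 - q ^ (Suc n - m)) * X m + q ^ (Suc n - m) * (1 - q ^ m) * X m"
      by (simp only: algebra_simps mult_1_left mult_1_right)
  qed
  \<comment> \<open>The first part vanishes at \<open>m = Suc n\<close>; the second vanishes at
    \<open>m = 0\<close> and is reindexed.\<close>
  also have "\<dots> = (\<Sum>m\<le>n. (1 - q ^ (Suc n - m)) * X m) +
      (\<Sum>m\<le>n. q ^ (n - m) * (1 - q ^ Suc m) * X (Suc m))"
    unfolding sum.distrib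
    by (subst (2) sum.atMost_Suc_shift) simp
  also have "(\<Sum>m\<le>n. (1 - q ^ (Suc n - m)) * X m) = 1 / (qpoch q q n * qpoch (B * q) q n)"
    unfolding IH1[symmetric]
  proof (intro sum.cong refl)
    fix m assume m: "m \<in> {..n}"
    have "1 - q ^ (Suc n - m) \<noteq> 0" using Suc.prems(1)[of "Suc n - m"] m by auto
    with m show "(1 - q ^ (Suc n - m)) * X m =
       B ^ m * q ^ m\<^sup>2 / (qpoch q q m * qpoch q q (n - m) * qpoch (B * q) q m)"
      by (simp add: X_def Suc_diff_le qpoch_q_Suc del: power_Suc)
  qed
  also have "(\<Sum>m\<le>n. q ^ (n - m) * (1 - q ^ Suc m) * X (Suc m)) =
      B * q ^ Suc n / (1 - B * q) * (1 / (qpoch q q n * qpoch (B * q * q) q n))"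
    unfolding IH2[symmetric] sum_distrib_left
  proof (intro sum.cong refl)
    fix m assume m: "m \<in> {..n}"
    have "1 - q ^ Suc m \<noteq> 0" using Suc.prems(1)[of "Suc m"] m by auto
    moreover have "n - m + (Suc m)\<^sup>2 = Suc n + m + m\<^sup>2"
      using m by (simp add: power2_eq_square)
    then have "q ^ (n - m) * q ^ (Suc m)\<^sup>2 = q ^ Suc n * q ^ m * q ^ m\<^sup>2"
      by (simp only: power_add[symmetric])
    then have "q ^ (n - m) * (B ^ Suc m * q ^ (Suc m)\<^sup>2) =
       B * q ^ Suc n * ((B * q) ^ m * q ^ m\<^sup>2)"
      by (simp add: power_mult_distrib mult_ac)
    ultimately show "q ^ (n - m) * (1 - q ^ Suc m) * X (Suc m) =
       B * q ^ Suc n / (1 - B * q) *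
       ((B * q) ^ m * q ^ m\<^sup>2 / (qpoch q q m * qpoch q q (n - m) * qpoch (B * q * q) q m))"
    proof -
      assume nz1: "1 - q ^ Suc m \<noteq> 0"
        and e: "q ^ (n - m) * (B ^ Suc m * q ^ (Suc m)\<^sup>2) = B * q ^ Suc n * ((B * q) ^ m * q ^ m\<^sup>2)"
      have "q ^ (n - m) * (1 - q ^ Suc m) * X (Suc m) =
        (1 - q ^ Suc m) * (q ^ (n - m) * (B ^ Suc m * q ^ (Suc m)\<^sup>2)) /
        ((1 - q ^ Suc m) * ((1 - B * q) * (qpoch q q m * qpoch q q (n - m) * qpoch (B * q * q) q m)))"
        by (simp add: X_def qpoch_q_Suc qpoch_Suc_shift[of "B * q"] mult_ac del: power_Suc)
      then show ?thesis
        unfolding e nonzero_mult_divide_mult_cancel_left[OF nz1] by simp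
    qed
  qed
  also have "1 / (qpoch q q n * qpoch (B * q) q n) +
      B * q ^ Suc n / (1 - B * q) * (1 / (qpoch q q n * qpoch (B * q * q) q n)) =
      1 / (qpoch q q n * qpoch (B * q) q (Suc n))"
    (is "?l + _ = _")
  proof -
    \<comment> \<open>Both parts thus have the common denominator
      \<open>(q;q)_n (Bq;q)_{n+1}\<close>, over which the numerators
      \<open>1 - B * q ^ Suc n\<close> and \<open>B * q ^ Suc n\<close> add up to 1.\<close>
    have e: "(1 - B * q) * qpoch (B * q * q) q n = qpoch (B * q) q n * (1 - B * q ^ Suc n)"
      using qpoch_Suc_shift[of "B * q" q n] qpoch_Suc[of "B * q" q n] by (simp add: mult.assoc)
    have "B * q ^ Suc n / (1 - B * q) * (1 / (qpoch q q n * qpoch (B * q * q) q n)) =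
      B * q ^ Suc n / (qpoch q q n * ((1 - B * q) * qpoch (B * q * q) q n))"
      by (simp add: mult_ac)
    then have "?l + B * q ^ Suc n / (1 - B * q) * (1 / (qpoch q q n * qpoch (B * q * q) q n)) =
      ?l + B * q ^ Suc n / (qpoch q q n * (qpoch (B * q) q n * (1 - B * q ^ Suc n)))"
      by (simp only: e)
    also have "\<dots> = 1 / (qpoch q q n * (qpoch (B * q) q n * (1 - B * q ^ Suc n)))"
      using nzBn nzP qnz[of n] by (simp add: field_simps)
    finally show ?thesis
      by (simp add: qpoch_Suc mult.assoc)
  qed
  finally have "(\<Sum>m\<le>Suc n. X m) = 1 / (qpoch q q n * qpoch (B * q) q (Suc n)) / (1 - q ^ Suc n)"
    using nz by (metis nonzero_mult_div_cancel_left)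
  then show ?case
    unfolding X_def by (simp add: qpoch_q_Suc mult_ac del: power_Suc sum.atMost_Suc)
qed

section \<open>Very-well-poised sums\<close>

text \<open>For generic \<open>A\<close> this is the entry beta_n of a Bailey pair relative to
  \<open>A\<close>, with alpha_i equal to \<open>g i\<close> times \<open>(-1)^i q^{i(i-1)/2} (1 - A
  q^{2i}) (A;q)_i / ((1 - A) (q;q)_i)\<close>. The quotient \<open>(A;q)_{n+i+1} / (A;q)_i\<close>
  is written as one product of fixed length, which \<open>qpoch_reverse\<close> can turn
  around.\<close>

definition wp_sum :: "'a::field \<Rightarrow> 'a \<Rightarrow> nat \<Rightarrow> (nat \<Rightarrow> 'a) \<Rightarrow> 'a" where
  "wp_sum q A n g =
    (\<Sum>i\<le>n. (-1) ^ i * q ^ (i choose 2) * (1 - A * q ^ (2 * i)) * g i /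
      (qpoch q q i * qpoch q q (n - i) * qpoch (A * q ^ i) q (Suc n)))"

lemma sum_triangle_swap:
  fixes f :: "nat \<Rightarrow> nat \<Rightarrow> 'a::comm_monoid_add"
  shows "(\<Sum>l\<le>n. \<Sum>i\<le>l. f l i) = (\<Sum>i\<le>n. \<Sum>m\<le>n - i. f (i + m) i)"
proof (induction n)
  case (Suc n)
  have "(\<Sum>i\<le>n. \<Sum>m\<le>Suc n - i. f (i + m) i) = (\<Sum>i\<le>n. (\<Sum>m\<le>n - i. f (i + m) i) + f (Suc n) i)"
    by (intro sum.cong refl) (simp add: Suc_diff_le)
  with Suc show ?case by (simp add: sum.distrib add.assoc)
qed simp

text \<open>After interchanging the sums and putting \<open>l = i + m\<close>, the part depending on
  \<open>m\<close> is the sum of \<open>q_vandermonde\<close> at \<open>B = A * q ^ (2 * i)\<close>;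
  the rest of \<open>A ^ l * q ^ l\<^sup>2\<close> is the new factor of \<open>g i\<close>.\<close>

lemma wp_sum_bailey:
  fixes q A :: "'a::field"
  assumes q: "\<And>j. 1 \<le> j \<Longrightarrow> j \<le> n \<Longrightarrow> q ^ j \<noteq> 1"
    and A: "\<And>m. m \<le> 2 * n \<Longrightarrow> A * q ^ m \<noteq> 1"
  shows "(\<Sum>l\<le>n. A ^ l * q ^ l\<^sup>2 / qpoch q q (n - l) * wp_sum q A l g) =
    wp_sum q A n (\<lambda>i. A ^ i * q ^ i\<^sup>2 * g i)"
proof -
  define c where "c = (\<lambda>i. (-1) ^ i * q ^ (i choose 2) * (1 - A * q ^ (2 * i)) * g i)"
  have "(\<Sum>l\<le>n. A ^ l * q ^ l\<^sup>2 / qpoch q q (n - l) * wp_sum q A l g) =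
     (\<Sum>l\<le>n. \<Sum>i\<le>l. A ^ l * q ^ l\<^sup>2 / qpoch q q (n - l) *
       (c i / (qpoch q q i * qpoch q q (l - i) * qpoch (A * q ^ i) q (Suc l))))"
    by (simp add: wp_sum_def c_def sum_distrib_left)
  also have "\<dots> = (\<Sum>i\<le>n. \<Sum>m\<le>n - i. A ^ (i + m) * q ^ (i + m)\<^sup>2 / qpoch q q (n - (i + m)) *
       (c i / (qpoch q q i * qpoch q q m * qpoch (A * q ^ i) q (Suc (i + m)))))"
    by (subst sum_triangle_swap) simp
  also have "\<dots> = wp_sum q A n (\<lambda>i. A ^ i * q ^ i\<^sup>2 * g i)"
    unfolding wp_sum_def
  proof (intro sum.cong refl)
    fix i assume i: "i \<in> {..n}"
    define B where "B = A * q ^ (2 * i)"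
    have split: "qpoch (A * q ^ i) q (Suc (i + m)) = qpoch (A * q ^ i) q (Suc i) * qpoch (B * q) q m" for m
    proof -
      have "A * q ^ i * q ^ Suc i = B * q"
        unfolding B_def mult_2 power_add by (simp add: mult_ac)
      then show ?thesis
        using qpoch_add[of "A * q ^ i" q "Suc i" m] by (simp only: add_Suc)
    qed
    have pow: "A ^ (i + m) * q ^ (i + m)\<^sup>2 = A ^ i * q ^ i\<^sup>2 * (B ^ m * q ^ m\<^sup>2)" for m
    proof -
      have "(i + m)\<^sup>2 = i\<^sup>2 + 2 * i * m + m\<^sup>2" by (simp add: power2_sum)
      then show ?thesis
        by (simp add: B_def power_add power_mult_distrib mult_ac flip: power_mult)
    qed
    have "B * q ^ j \<noteq> 1" if "1 \<le> j" "j \<le> n - i" for j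
    proof -
      have "2 * i + j \<le> 2 * n" using that i by simp
      from A[OF this] show ?thesis by (simp add: B_def power_add mult.assoc)
    qed
    with q have V: "(\<Sum>m\<le>n - i. B ^ m * q ^ m\<^sup>2 / (qpoch q q m * qpoch q q (n - i - m) * qpoch (B * q) q m)) =
        1 / (qpoch q q (n - i) * qpoch (B * q) q (n - i))"
      by (intro q_vandermonde) auto
    have "(\<Sum>m\<le>n - i. A ^ (i + m) * q ^ (i + m)\<^sup>2 / qpoch q q (n - (i + m)) *
         (c i / (qpoch q q i * qpoch q q m * qpoch (A * q ^ i) q (Suc (i + m))))) =
       A ^ i * q ^ i\<^sup>2 * c i / (qpoch q q i * qpoch (A * q ^ i) q (Suc i)) *
       (\<Sum>m\<le>n - i. B ^ m * q ^ m\<^sup>2 / (qpoch q q m * qpoch q q (n - i - m) * qpoch (B * q) q m))"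
      unfolding pow split sum_distrib_left by (intro sum.cong refl) (simp add: mult_ac)
    also have "\<dots> = c i * (A ^ i * q ^ i\<^sup>2) /
        (qpoch q q i * qpoch q q (n - i) * (qpoch (A * q ^ i) q (Suc i) * qpoch (B * q) q (n - i)))"
      unfolding V by (simp add: mult_ac)
    also have "qpoch (A * q ^ i) q (Suc i) * qpoch (B * q) q (n - i) = qpoch (A * q ^ i) q (Suc n)"
      using split[of "n - i"] i by simp
    finally show "(\<Sum>m\<le>n - i. A ^ (i + m) * q ^ (i + m)\<^sup>2 / qpoch q q (n - (i + m)) *
         (c i / (qpoch q q i * qpoch q q m * qpoch (A * q ^ i) q (Suc (i + m))))) =
       (-1) ^ i * q ^ (i choose 2) * (1 - A * q ^ (2 * i)) * (A ^ i * q ^ i\<^sup>2 * g i) /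
        (qpoch q q i * qpoch q q (n - i) * qpoch (A * q ^ i) q (Suc n))"
      by (simp add: c_def mult_ac)
  qed
  finally show ?thesis .
qed

text \<open>The factor \<open>(1 - q ^ Suc n) * (1 - A * q ^ (2 * i))\<close> splits into two
  products, each cancelling end factors of the denominator. Shifting the index in one of them makes
  neighbouring terms combine to \<open>g i - g (Suc i)\<close>. The division by
  \<open>1 - A * q ^ (2 * i + 1)\<close> compensates the very-well-poised factor for
  \<open>A * q\<close>.\<close>

lemma wp_sum_raise:
  fixes q A :: "'a::field"
  assumes q: "\<And>j. 1 \<le> j \<Longrightarrow> j \<le> Suc n \<Longrightarrow> q ^ j \<noteq> 1"
    and A: "\<And>m. m \<le> 2 * Suc n \<Longrightarrow> A * q ^ m \<noteq> 1"
  shows "(1 - q ^ Suc n) * wp_sum q A (Suc n) g =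
    wp_sum q (A * q) n (\<lambda>i. q ^ i * (g i - g (Suc i)) / (1 - A * q ^ (2 * i + 1)))"
proof -
  define X where "X = (\<lambda>i. (-1) ^ i * q ^ (i choose 2) * g i /
    (qpoch q q i * qpoch q q (Suc n - i) * qpoch (A * q ^ i) q (Suc (Suc n))))"
  have "(1 - q ^ Suc n) * wp_sum q A (Suc n) g =
     (\<Sum>i\<le>Suc n. (1 - q ^ i) * (1 - A * q ^ (Suc n + i)) * X i + q ^ i * (1 - A * q ^ i) * (1 - q ^ (Suc n - i)) * X i)"
    unfolding wp_sum_def sum_distrib_left
  proof (intro sum.cong refl)
    fix i assume i: "i \<in> {..Suc n}"
    define y where "y = q ^ (Suc n - i)"
    have y: "q ^ Suc n = q ^ i * y"
      using i by (simp add: y_def flip: power_add del: power_Suc)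
    have "(1 - q ^ Suc n) * ((-1) ^ i * q ^ (i choose 2) * (1 - A * q ^ (2 * i)) * g i /
        (qpoch q q i * qpoch q q (Suc n - i) * qpoch (A * q ^ i) q (Suc (Suc n)))) =
        (1 - q ^ Suc n) * (1 - A * q ^ (2 * i)) * X i"
      by (simp add: X_def mult_ac)
    also have "(1 - q ^ Suc n) * (1 - A * q ^ (2 * i)) =
      (1 - q ^ i) * (1 - A * q ^ (Suc n + i)) + q ^ i * (1 - A * q ^ i) * (1 - y)"
      unfolding power_add mult_2 y by (simp add: algebra_simps)
    finally show "(1 - q ^ Suc n) * ((-1) ^ i * q ^ (i choose 2) * (1 - A * q ^ (2 * i)) * g i /
        (qpoch q q i * qpoch q q (Suc n - i) * qpoch (A * q ^ i) q (Suc (Suc n)))) =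
      (1 - q ^ i) * (1 - A * q ^ (Suc n + i)) * X i + q ^ i * (1 - A * q ^ i) * (1 - q ^ (Suc n - i)) * X i"
      unfolding y_def by (simp only: distrib_right)
  qed
  \<comment> \<open>The first part vanishes at \<open>i = 0\<close> and is shifted; the second
    vanishes at \<open>i = Suc n\<close>.\<close>
  also have "\<dots> = (\<Sum>i\<le>n. (1 - q ^ Suc i) * (1 - A * q ^ (Suc n + Suc i)) * X (Suc i) +
      q ^ i * (1 - A * q ^ i) * (1 - q ^ (Suc n - i)) * X i)"
    unfolding sum.distrib by (subst sum.atMost_Suc_shift) simp
  also have "\<dots> = wp_sum q (A * q) n (\<lambda>i. q ^ i * (g i - g (Suc i)) / (1 - A * q ^ (2 * i + 1)))"
    unfolding wp_sum_def
  proof (intro sum.cong refl)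
    fix i assume i: "i \<in> {..n}"
    define D where "D = qpoch q q i * qpoch q q (n - i) * qpoch (A * q * q ^ i) q (Suc n)"
    define s where "s = (-1) ^ i * q ^ (i choose 2)"
    have nz1: "1 - q ^ Suc i \<noteq> 0" using q[of "Suc i"] i by auto
    have nz2: "1 - q ^ (Suc n - i) \<noteq> 0" using q[of "Suc n - i"] i by auto
    have nz3: "1 - A * q ^ i \<noteq> 0" using A[of i] i by auto
    have nz4: "1 - A * q ^ (Suc n + Suc i) \<noteq> 0" using A[of "Suc n + Suc i"] i by auto
    have nz5: "1 - A * q ^ (2 * i + 1) \<noteq> 0" using A[of "2 * i + 1"] i by auto
    have "qpoch (A * q ^ Suc i) q (Suc (Suc n)) =
        qpoch (A * q * q ^ i) q (Suc n) * (1 - A * q ^ (Suc n + Suc i))"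
      by (subst qpoch_Suc) (simp add: power_add mult_ac)
    moreover have "(-1) ^ Suc i = - ((-1) ^ i :: 'a)" by simp
    ultimately have "X (Suc i) = - (s * q ^ i * g (Suc i)) / ((1 - q ^ Suc i) * (1 - A * q ^ (Suc n + Suc i)) * D)"
      by (simp add: X_def s_def D_def choose_two_Suc qpoch_q_Suc power_add[of q i] mult_ac
        del: power_Suc add_Suc add_Suc_right)
    then have 1: "(1 - q ^ Suc i) * (1 - A * q ^ (Suc n + Suc i)) * X (Suc i) = - (s * q ^ i * g (Suc i)) / D"
      using nz1 nz4 by (simp del: power_Suc add_Suc add_Suc_right)
    have "X i = s * g i / ((1 - A * q ^ i) * (1 - q ^ (Suc n - i)) * D)"
      using i by (simp add: X_def s_def D_def Suc_diff_le qpoch_q_Suc qpoch_Suc_shift[of "A * q ^ i" q "Suc n"]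
         mult_ac)
    then have 2: "q ^ i * (1 - A * q ^ i) * (1 - q ^ (Suc n - i)) * X i = s * q ^ i * g i / D"
      using nz2 nz3 by simp
    have "(1 - q ^ Suc i) * (1 - A * q ^ (Suc n + Suc i)) * X (Suc i) +
        q ^ i * (1 - A * q ^ i) * (1 - q ^ (Suc n - i)) * X i = s * (q ^ i * (g i - g (Suc i))) / D"
      unfolding 1 2 by (simp add: field_simps flip: add_divide_distrib)
    also have "\<dots> = s * ((1 - A * q ^ (2 * i + 1)) * (q ^ i * (g i - g (Suc i)) / (1 - A * q ^ (2 * i + 1)))) / D"
      using nz5 by simp
    finally show "(1 - q ^ Suc i) * (1 - A * q ^ (Suc n + Suc i)) * X (Suc i) +
        q ^ i * (1 - A * q ^ i) * (1 - q ^ (Suc n - i)) * X i =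
      (-1) ^ i * q ^ (i choose 2) * (1 - A * q * q ^ (2 * i)) *
        (q ^ i * (g i - g (Suc i)) / (1 - A * q ^ (2 * i + 1))) /
        (qpoch q q i * qpoch q q (n - i) * qpoch (A * q * q ^ i) q (Suc n))"
      by (simp add: s_def D_def mult.assoc)
  qed
  finally show ?thesis .
qed

text \<open>A constant coefficient has zero differences, so \<open>wp_sum_raise\<close> annihilates
  it.\<close>

lemma wp_sum_one:
  fixes q A :: "'a::field"
  assumes "\<And>j. 1 \<le> j \<Longrightarrow> j \<le> Suc n \<Longrightarrow> q ^ j \<noteq> 1"
    and "\<And>m. m \<le> 2 * Suc n \<Longrightarrow> A * q ^ m \<noteq> 1"
  shows "wp_sum q A (Suc n) (\<lambda>_. 1) = 0"
proof -
  have "(1 - q ^ Suc n) * wp_sum q A (Suc n) (\<lambda>_. 1) = 0"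
    by (subst wp_sum_raise) (use assms in \<open>auto simp: wp_sum_def\<close>)
  with assms(1)[of "Suc n"] show ?thesis by simp
qed

text \<open>The difference of \<open>(1 - t q\<^bsup>n+1\<^esup>)\<^sup>2\<close> times the sum for \<open>n + 1\<close> and the sum for \<open>n\<close> is termwise
  \<open>q\<^bsup>n+1\<^esup>\<close> times the vanishing sum of \<open>wp_sum_one\<close>.\<close>

lemma wp_sum_square:
  fixes q t :: "'a::field"
  assumes "\<And>j. 1 \<le> j \<Longrightarrow> j \<le> n \<Longrightarrow> q ^ j \<noteq> 1"
    and "\<And>j. j \<le> n \<Longrightarrow> t * q ^ j \<noteq> 1"
    and "\<And>m. m \<le> 2 * n \<Longrightarrow> t\<^sup>2 * q ^ m \<noteq> 1"
  shows "wp_sum q (t\<^sup>2) n (\<lambda>i. q ^ i / (1 - t * q ^ i)\<^sup>2) = 1 / (qpoch t q (Suc n))\<^sup>2"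
  using assms
proof (induction n)
  case 0
  from "0.prems"(3)[of 0] have "1 - t\<^sup>2 \<noteq> 0" by simp
  then show ?case by (simp add: wp_sum_def qpoch_Suc choose_two_0)
next
  case (Suc n)
  define a where "a = t\<^sup>2"
  define e where "e = (\<lambda>i. (-1) ^ i * q ^ (i choose 2) * (1 - a * q ^ (2 * i)) /
      (qpoch q q i * qpoch q q (Suc n - i) * qpoch (a * q ^ i) q (Suc (Suc n))))"
  define f where "f = (\<lambda>i. q ^ i / (1 - t * q ^ i)\<^sup>2)"
  have "(1 - t * q ^ Suc n)\<^sup>2 * wp_sum q a (Suc n) f =
     (\<Sum>i\<le>Suc n. (1 - q ^ (Suc n - i)) * (1 - a * q ^ (i + Suc n)) * (e i * f i) + q ^ Suc n * e i)"
    unfolding wp_sum_def sum_distrib_left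
  proof (intro sum.cong refl)
    fix i assume i: "i \<in> {..Suc n}"
    define x z where "x = t * q ^ i" and "z = q ^ (Suc n - i)"
    have nz: "1 - x \<noteq> 0" using Suc.prems(2)[of i] i by (simp add: x_def)
    have qz: "q ^ Suc n = q ^ i * z"
      using i by (simp add: z_def flip: power_add del: power_Suc)
    have y: "t * q ^ Suc n = x * z" by (simp only: qz x_def mult.assoc)
    have az: "a * q ^ (i + Suc n) = x\<^sup>2 * z"
      by (simp only: power_add qz) (simp add: a_def x_def power2_eq_square mult_ac)
    \<comment> \<open>In this splitting the first product cancels the two factors by which the
      denominators for \<open>Suc n\<close> and \<open>n\<close> differ; the second clears the
      double pole of \<open>f i\<close>.\<close>
    have "(1 - t * q ^ Suc n)\<^sup>2 = (1 - z) * (1 - x\<^sup>2 * z) + z * (1 - x)\<^sup>2"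
      unfolding y by (simp add: power2_eq_square algebra_simps)
    then have "(1 - t * q ^ Suc n)\<^sup>2 * (e i * f i) =
        (1 - z) * (1 - x\<^sup>2 * z) * (e i * f i) + z * (1 - x)\<^sup>2 * (e i * f i)"
      by (simp only: distrib_right)
    also have "z * (1 - x)\<^sup>2 * (e i * f i) = q ^ Suc n * e i"
      using nz unfolding f_def qz by (simp add: x_def[symmetric])
    finally show "(1 - t * q ^ Suc n)\<^sup>2 *
        ((-1) ^ i * q ^ (i choose 2) * (1 - a * q ^ (2 * i)) * f i /
          (qpoch q q i * qpoch q q (Suc n - i) * qpoch (a * q ^ i) q (Suc (Suc n)))) =
       (1 - q ^ (Suc n - i)) * (1 - a * q ^ (i + Suc n)) * (e i * f i) + q ^ Suc n * e i"
      unfolding az z_def[symmetric] by (simp add: e_def mult_ac)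
  qed
  also have "\<dots> = (\<Sum>i\<le>n. (1 - q ^ (Suc n - i)) * (1 - a * q ^ (i + Suc n)) * (e i * f i)) +
      q ^ Suc n * (\<Sum>i\<le>Suc n. e i)"
    unfolding sum.distrib sum_distrib_left by simp
  also have "(\<Sum>i\<le>Suc n. e i) = wp_sum q a (Suc n) (\<lambda>_. 1)"
    by (simp add: wp_sum_def e_def del: sum.atMost_Suc)
  also have "\<dots> = 0"
    using Suc.prems by (intro wp_sum_one) (auto simp: a_def)
  also have "(\<Sum>i\<le>n. (1 - q ^ (Suc n - i)) * (1 - a * q ^ (i + Suc n)) * (e i * f i)) = wp_sum q a n f"
    unfolding wp_sum_def
  proof (intro sum.cong refl)
    fix i assume i: "i \<in> {..n}"
    define p where "p = qpoch (a * q ^ i) q (Suc n)"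
    have nz1: "1 - q ^ (Suc n - i) \<noteq> 0" using Suc.prems(1)[of "Suc n - i"] i by auto
    have nz2: "1 - a * q ^ (i + Suc n) \<noteq> 0" using Suc.prems(3)[of "i + Suc n"] i by (auto simp: a_def)
    have p: "qpoch (a * q ^ i) q (Suc (Suc n)) = p * (1 - a * q ^ (i + Suc n))"
      by (subst qpoch_Suc) (simp add: p_def power_add mult_ac)
    have "qpoch q q (Suc n - i) = qpoch q q (n - i) * (1 - q ^ (Suc n - i))"
      using i by (simp add: Suc_diff_le qpoch_q_Suc del: power_Suc)
    then show "(1 - q ^ (Suc n - i)) * (1 - a * q ^ (i + Suc n)) * (e i * f i) =
      (-1) ^ i * q ^ (i choose 2) * (1 - a * q ^ (2 * i)) * f i /
        (qpoch q q i * qpoch q q (n - i) * qpoch (a * q ^ i) q (Suc n))"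
      using nz1 nz2 unfolding e_def p p_def[symmetric] by (simp add: mult.assoc)
  qed
  also have "wp_sum q a n f = 1 / (qpoch t q (Suc n))\<^sup>2"
    unfolding a_def f_def using Suc.prems by (intro Suc.IH) auto
  finally have "(1 - t * q ^ Suc n)\<^sup>2 * wp_sum q a (Suc n) f = 1 / (qpoch t q (Suc n))\<^sup>2"
    by simp
  moreover have "1 - t * q ^ Suc n \<noteq> 0" using Suc.prems(2)[of "Suc n"] by simp
  ultimately have "wp_sum q a (Suc n) f = 1 / (qpoch t q (Suc n))\<^sup>2 / (1 - t * q ^ Suc n)\<^sup>2"
    by (metis nonzero_mult_div_cancel_left power_not_zero)
  then show ?case
    unfolding a_def f_def by (simp only: qpoch_Suc[of t q "Suc n"] power_mult_distrib divide_divide_eq_left)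
qed

section \<open>Reversal of the order of summation\<close>

text \<open>Factor \<open>j\<close> on the left is \<open>-(1 - C q^{n-j}) / (C q^{n-j})\<close>, so
  the factors on the right occur in the opposite order.\<close>

lemma qpoch_reverse:
  fixes q C :: "'a::field"
  assumes "q \<noteq> 0" "C \<noteq> 0"
  shows "qpoch (1 / (C * q ^ n)) q (Suc n) = (-1) ^ Suc n * qpoch C q (Suc n) / (C ^ Suc n * q ^ (Suc n choose 2))"
proof (induction n)
  case 0
  with assms show ?case by (simp add: qpoch_Suc field_simps choose_two_0 choose_two_Suc)
next
  case (Suc n)
  have "qpoch (1 / (C * q ^ Suc n)) q (Suc (Suc n)) =
      (1 - 1 / (C * q ^ Suc n)) * qpoch (1 / (C * q ^ n)) q (Suc n)"
    using assms by (subst qpoch_Suc_shift) simp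
  also have "1 - 1 / (C * q ^ Suc n) = (-1) * (1 - C * q ^ Suc n) / (C * q ^ Suc n)"
    using assms by (simp add: field_simps)
  also note Suc.IH
  finally show ?case
    by (simp only: qpoch_Suc[of C q "Suc n"] choose_two_Suc[of "Suc n"] power_add
      power_Suc[of _ "Suc n"] times_divide_times_eq mult_ac)
qed

text \<open>The balance of the exponents of \<open>q\<close> in \<open>wp_sum_reverse\<close>, with
  \<open>n = i + m\<close>.\<close>

lemma choose_two_reverse:
  "((m::nat) choose 2) + i * (Suc (i + m)) + (Suc (i + m) choose 2) = (i + m)\<^sup>2 + (i choose 2) + 2 * i"
  by (induction m) (simp_all add: choose_two_Suc power2_eq_square algebra_simps)

text \<open>With \<open>m = n - i\<close>, the base \<open>B = 1 / (A * q ^ (2 * n))\<close>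
  satisfies \<open>B q^{2m} = 1 / (A q^{2i})\<close>. Hence the very-well-poised factor and the
  shifted factorial of the reversed term are those of the original one up to signs and
  powers.\<close>

lemma wp_sum_reverse:
  fixes q A :: "'a::field"
  assumes "q \<noteq> 0" "A \<noteq> 0"
  shows "wp_sum q (1 / (A * q ^ (2 * n))) n (\<lambda>i. g (n - i)) = A ^ n * q ^ n\<^sup>2 * wp_sum q A n g"
  unfolding wp_sum_def sum_distrib_left
proof (rule sum.reindex_bij_witness[of _ "\<lambda>i. n - i" "\<lambda>i. n - i"])
  fix i' assume "i' \<in> {..n}"
  define i m where "i = n - i'" and "m = i'"
  with \<open>i' \<in> {..n}\<close> have n: "n = i + m" by simp
  have B: "1 / (A * q ^ (2 * n)) * q ^ m = 1 / (A * q ^ i * q ^ n)"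
    using assms unfolding n mult_2 power_add by (simp add: field_simps)
  have B2: "1 - 1 / (A * q ^ (2 * n)) * q ^ (2 * m) = - (1 - A * q ^ (2 * i)) / (A * q ^ (2 * i))"
    using assms unfolding n mult_2 power_add by (simp add: field_simps)
  have e: "q ^ (m choose 2) * (q ^ i) ^ Suc n * q ^ (Suc n choose 2) = q ^ n\<^sup>2 * q ^ (i choose 2) * q ^ (2 * i)"
    unfolding power_mult[symmetric] power_add[symmetric] n choose_two_reverse ..
  define w where "w = 1 - A * q ^ (2 * i)"
  \<comment> \<open>The remaining minus sign cancels against the one in \<open>B2\<close>.\<close>
  have s: "(-1) ^ m * (-1) ^ Suc n = - ((-1) ^ i :: 'a)"
    unfolding n by (simp add: power_add mult_ac flip: power_mult_distrib)
  \<comment> \<open>Only \<open>A\<close> and the sign are cancelled. The equation therefore covers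
    vanishing \<open>P\<close> or \<open>d\<close>, where both sides are 0 because division by zero
    gives 0.\<close>
  have signs: "x * c * (w / (A * u)) * y / (d * ((-1) ^ Suc n * P / (A ^ Suc n * V * v))) =
      (x * (-1) ^ Suc n) * (c * V * v) * w * A ^ n * y / (u * (d * P))" for x c w u y d P V v
  proof -
    have "inverse ((-1) ^ Suc n :: 'a) = (-1) ^ Suc n"
      by (simp add: power_inverse[symmetric])
    moreover have "inverse A * A ^ Suc n = A ^ n" using assms by simp
    moreover have "x * c * (w / (A * u)) * y / (d * ((-1) ^ Suc n * P / (A ^ Suc n * V * v))) =
      (x * inverse ((-1) ^ Suc n)) * (c * V * v) * w * (inverse A * A ^ Suc n) * y / (u * (d * P))"
      by (simp only: divide_inverse inverse_mult_distrib inverse_inverse_eq mult_ac)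
    ultimately show ?thesis by (simp only:)
  qed
  have "(-1) ^ m * q ^ (m choose 2) * (- (1 - A * q ^ (2 * i)) / (A * q ^ (2 * i))) * g i /
        (qpoch q q m * qpoch q q i * ((-1) ^ Suc n * qpoch (A * q ^ i) q (Suc n) / ((A * q ^ i) ^ Suc n * q ^ (Suc n choose 2)))) =
      ((-1) ^ m * (-1) ^ Suc n) * (q ^ (m choose 2) * (q ^ i) ^ Suc n * q ^ (Suc n choose 2)) *
        (- (1 - A * q ^ (2 * i))) * A ^ n * g i / (q ^ (2 * i) * (qpoch q q m * qpoch q q i * qpoch (A * q ^ i) q (Suc n)))"
    by (simp only: power_mult_distrib[of A] signs)
  also have "\<dots> = A ^ n * q ^ n\<^sup>2 *
      ((-1) ^ i * q ^ (i choose 2) * (1 - A * q ^ (2 * i)) * g i /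
        (qpoch q q i * qpoch q q m * qpoch (A * q ^ i) q (Suc n)))"
    unfolding e s w_def[symmetric] using assms by (simp add: mult_ac)
  finally have *: "(-1) ^ m * q ^ (m choose 2) * (- (1 - A * q ^ (2 * i)) / (A * q ^ (2 * i))) * g i /
        (qpoch q q m * qpoch q q i * ((-1) ^ Suc n * qpoch (A * q ^ i) q (Suc n) / ((A * q ^ i) ^ Suc n * q ^ (Suc n choose 2)))) =
      A ^ n * q ^ n\<^sup>2 *
      ((-1) ^ i * q ^ (i choose 2) * (1 - A * q ^ (2 * i)) * g i /
        (qpoch q q i * qpoch q q m * qpoch (A * q ^ i) q (Suc n)))" .
  have idx: "n - i' = i" "i' = m" "n - i = m"
    using n by (simp_all add: i_def m_def)
  have rev: "qpoch (1 / (A * q ^ i * q ^ n)) q (Suc n) =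
      (-1) ^ Suc n * qpoch (A * q ^ i) q (Suc n) / ((A * q ^ i) ^ Suc n * q ^ (Suc n choose 2))"
    using assms by (intro qpoch_reverse) auto
  show "A ^ n * q ^ n\<^sup>2 *
      ((-1) ^ (n - i') * q ^ (n - i' choose 2) * (1 - A * q ^ (2 * (n - i'))) * g (n - i') /
        (qpoch q q (n - i') * qpoch q q (n - (n - i')) * qpoch (A * q ^ (n - i')) q (Suc n))) =
     (-1) ^ i' * q ^ (i' choose 2) * (1 - 1 / (A * q ^ (2 * n)) * q ^ (2 * i')) * g (n - i') /
        (qpoch q q i' * qpoch q q (n - i') * qpoch (1 / (A * q ^ (2 * n)) * q ^ i') q (Suc n))"
    unfolding idx(1) unfolding idx(2,3) B B2 rev by (rule *[symmetric])
qed auto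

section \<open>Reflection of the base\<close>

text \<open>\<open>u\<close> and \<open>v\<close> stand for the same quantity at \<open>t\<close> and at \<open>1/(t q\<^sup>N)\<close>.\<close>

definition wp_dual :: "'a::field \<Rightarrow> 'a \<Rightarrow> nat \<Rightarrow> 'a \<Rightarrow> (nat \<Rightarrow> 'a) \<Rightarrow> (nat \<Rightarrow> 'a) \<Rightarrow> bool" where
  "wp_dual q A n c u v \<longleftrightarrow>
    (\<exists>g h. (\<forall>l\<le>n. u l = wp_sum q A l g \<and> v l = wp_sum q (1 / (A * q ^ (2 * n))) l h) \<and>
      (\<forall>i\<le>n. h i = c * g (n - i)))"

lemma wp_dual_cong:
  assumes "wp_dual q A n c u v"
    and "c = c'" and "\<And>l. l \<le> n \<Longrightarrow> u l = u' l" and "\<And>l. l \<le> n \<Longrightarrow> v l = v' l"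
  shows "wp_dual q A n c' u' v'"
  using assms unfolding wp_dual_def by metis

lemma wp_sum_cong: "(\<And>i. i \<le> n \<Longrightarrow> g i = h i) \<Longrightarrow> wp_sum q A n g = wp_sum q A n h"
  unfolding wp_sum_def by (intro sum.cong) auto

lemma wp_sum_scale: "wp_sum q A n (\<lambda>i. c * g i) = c * wp_sum q A n g"
  unfolding wp_sum_def by (simp add: sum_distrib_left mult_ac)

text \<open>The reflected base involves \<open>n\<close>, so the sums can be reversed at the top
  index \<open>n\<close> only. The entries below it serve the later steps, which sum over
  them.\<close>

lemma wp_dual_last:
  assumes "q \<noteq> 0" "A \<noteq> 0" "wp_dual q A n c u v"
  shows "v n = c * A ^ n * q ^ n\<^sup>2 * u n"
proof -
  from assms(3) obtain g h where
    *: "u n = wp_sum q A n g" "v n = wp_sum q (1 / (A * q ^ (2 * n))) n h" "\<And>i. i \<le> n \<Longrightarrow> h i = c * g (n - i)"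
    unfolding wp_dual_def by blast
  have "v n = wp_sum q (1 / (A * q ^ (2 * n))) n (\<lambda>i. c * g (n - i))"
    unfolding *(2) by (intro wp_sum_cong *(3))
  also have "\<dots> = c * (A ^ n * q ^ n\<^sup>2 * wp_sum q A n g)"
    by (simp only: wp_sum_scale[of q _ n c "\<lambda>i. g (n - i)"] wp_sum_reverse[OF assms(1,2), of n g])
  finally show ?thesis by (simp add: *(1) mult_ac)
qed

text \<open>The reflection sends the exponent \<open>m\<close> to \<open>2 * n - m\<close>, so it
  permutes the excluded values.\<close>

lemma wp_dual_base_neq:
  fixes q A :: "'a::field"
  assumes "q \<noteq> 0" "A \<noteq> 0" "\<And>m. m \<le> 2 * n \<Longrightarrow> A * q ^ m \<noteq> 1" "m \<le> 2 * n"
  shows "1 / (A * q ^ (2 * n)) * q ^ m \<noteq> 1"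
proof -
  have "q ^ (2 * n) = q ^ (2 * n - m) * q ^ m" using assms(4) by (simp flip: power_add)
  then have "1 / (A * q ^ (2 * n)) * q ^ m = 1 / (A * q ^ (2 * n - m))"
    using assms(1) by simp
  moreover have "A * q ^ (2 * n - m) \<noteq> 1" by (rule assms(3)) simp
  ultimately show ?thesis using assms(1,2) by simp
qed

lemma wp_dual_scale:
  assumes "\<kappa> \<noteq> 0" "wp_dual q A n c u v"
  shows "wp_dual q A n (c * \<kappa>' / \<kappa>) (\<lambda>l. \<kappa> * u l) (\<lambda>l. \<kappa>' * v l)"
proof -
  from assms(2) obtain g h where
    "\<forall>l\<le>n. u l = wp_sum q A l g \<and> v l = wp_sum q (1 / (A * q ^ (2 * n))) l h" "\<forall>i\<le>n. h i = c * g (n - i)"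
    unfolding wp_dual_def by blast
  with assms(1) show ?thesis unfolding wp_dual_def
    by (intro exI[of _ "\<lambda>i. \<kappa> * g i"] exI[of _ "\<lambda>i. \<kappa>' * h i"]) (simp add: wp_sum_scale)
qed

text \<open>The multipliers \<open>A ^ i * q ^ i\<^sup>2\<close> and
  \<open>B ^ i * q ^ i\<^sup>2\<close> are reversals of each other up to the constant
  \<open>A ^ n * q ^ n\<^sup>2\<close>, because
  \<open>i^2 - 2 n i = (n - i)^2 - n^2\<close>.\<close>

lemma wp_dual_bailey:
  fixes q A :: "'a::field"
  assumes q0: "q \<noteq> 0" and A0: "A \<noteq> 0"
    and q: "\<And>j. 1 \<le> j \<Longrightarrow> j \<le> n \<Longrightarrow> q ^ j \<noteq> 1"
    and A: "\<And>m. m \<le> 2 * n \<Longrightarrow> A * q ^ m \<noteq> 1"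
    and dual: "wp_dual q A n c u v"
    and B: "B = 1 / (A * q ^ (2 * n))"
  shows "wp_dual q A n (c / (A ^ n * q ^ n\<^sup>2))
    (\<lambda>l. \<Sum>m\<le>l. A ^ m * q ^ m\<^sup>2 / qpoch q q (l - m) * u m)
    (\<lambda>l. \<Sum>m\<le>l. B ^ m * q ^ m\<^sup>2 / qpoch q q (l - m) * v m)"
proof -
  from dual obtain g h where
    u: "\<And>l. l \<le> n \<Longrightarrow> u l = wp_sum q A l g"
    and v: "\<And>l. l \<le> n \<Longrightarrow> v l = wp_sum q B l h"
    and h: "\<And>i. i \<le> n \<Longrightarrow> h i = c * g (n - i)"
    unfolding wp_dual_def B by blast
  have Bneq: "B * q ^ m \<noteq> 1" if "m \<le> 2 * n" for m
    unfolding B using q0 A0 A that by (rule wp_dual_base_neq)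
  have U: "(\<Sum>m\<le>l. A ^ m * q ^ m\<^sup>2 / qpoch q q (l - m) * u m) = wp_sum q A l (\<lambda>i. A ^ i * q ^ i\<^sup>2 * g i)"
    if "l \<le> n" for l
    using that q A by (subst wp_sum_bailey[symmetric]) (auto simp: u)
  have V: "(\<Sum>m\<le>l. B ^ m * q ^ m\<^sup>2 / qpoch q q (l - m) * v m) = wp_sum q B l (\<lambda>i. B ^ i * q ^ i\<^sup>2 * h i)"
    if "l \<le> n" for l
    using that q Bneq by (subst wp_sum_bailey[symmetric]) (auto simp: v)
  have "B ^ i * q ^ i\<^sup>2 * h i = c / (A ^ n * q ^ n\<^sup>2) * (A ^ (n - i) * q ^ (n - i)\<^sup>2 * g (n - i))"
    if "i \<le> n" for i
  proof -
    define m where "m = n - i"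
    have n: "n = i + m" using that by (simp add: m_def)
    have e: "2 * (i + m) * i + m\<^sup>2 = i\<^sup>2 + (i + m)\<^sup>2"
      by (simp add: power2_eq_square algebra_simps)
    have Bi: "B ^ i * (A ^ i * q ^ (2 * n * i)) = 1"
      unfolding B using q0 A0 by (simp add: power_mult power_one_over power_mult_distrib)
    have qs: "q ^ i\<^sup>2 * q ^ n\<^sup>2 = q ^ (2 * n * i) * q ^ m\<^sup>2"
      unfolding power_add[symmetric] n e ..
    have "B ^ i * q ^ i\<^sup>2 * (A ^ n * q ^ n\<^sup>2) = B ^ i * A ^ n * (q ^ i\<^sup>2 * q ^ n\<^sup>2)"
      by (simp only: mult_ac)
    also have "\<dots> = (B ^ i * (A ^ i * q ^ (2 * n * i))) * (A ^ m * q ^ m\<^sup>2)"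
      unfolding qs unfolding n power_add[of A] by (simp only: mult_ac)
    finally have "B ^ i * q ^ i\<^sup>2 * (A ^ n * q ^ n\<^sup>2) = (B ^ i * (A ^ i * q ^ (2 * n * i))) * (A ^ m * q ^ m\<^sup>2)" .
    then have "B ^ i * q ^ i\<^sup>2 = A ^ m * q ^ m\<^sup>2 / (A ^ n * q ^ n\<^sup>2)"
      unfolding Bi using q0 A0 by (simp add: eq_divide_eq)
    then show ?thesis
      unfolding h[OF that] m_def by simp
  qed
  with U V show ?thesis
    unfolding wp_dual_def B[symmetric] by blast
qed

text \<open>Reversal negates the difference of neighbouring coefficients, and
  \<open>1 - 1 / z = - (1 - z) / z\<close> supplies the sign that cancels this. The bases stay
  reflections of each other since \<open>n\<close> drops by one while both are multiplied by
  \<open>q\<close>.\<close>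

lemma wp_dual_raise:
  fixes q A :: "'a::field"
  assumes q0: "q \<noteq> 0" and A0: "A \<noteq> 0"
    and q: "\<And>j. 1 \<le> j \<Longrightarrow> j \<le> Suc n \<Longrightarrow> q ^ j \<noteq> 1"
    and A: "\<And>m. m \<le> 2 * Suc n \<Longrightarrow> A * q ^ m \<noteq> 1"
    and dual: "wp_dual q A (Suc n) c u v"
  shows "wp_dual q (A * q) n (c * (A * q ^ Suc n))
    (\<lambda>l. (1 - q ^ Suc l) * u (Suc l)) (\<lambda>l. (1 - q ^ Suc l) * v (Suc l))"
proof -
  define B where "B = 1 / (A * q ^ (2 * Suc n))"
  from dual obtain g h where
    u: "\<And>l. l \<le> Suc n \<Longrightarrow> u l = wp_sum q A l g"
    and v: "\<And>l. l \<le> Suc n \<Longrightarrow> v l = wp_sum q B l h"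
    and h: "\<And>i. i \<le> Suc n \<Longrightarrow> h i = c * g (Suc n - i)"
    unfolding wp_dual_def B_def by blast
  have Bneq: "B * q ^ m \<noteq> 1" if "m \<le> 2 * Suc n" for m
    unfolding B_def using q0 A0 A that by (rule wp_dual_base_neq)
  have Bq: "1 / (A * q * q ^ (2 * n)) = B * q"
    using q0 A0 by (simp add: B_def field_simps)
  define g' where "g' = (\<lambda>i. q ^ i * (g i - g (Suc i)) / (1 - A * q ^ (2 * i + 1)))"
  define h' where "h' = (\<lambda>i. q ^ i * (h i - h (Suc i)) / (1 - B * q ^ (2 * i + 1)))"
  have U: "(1 - q ^ Suc l) * u (Suc l) = wp_sum q (A * q) l g'" if "l \<le> n" for l
    unfolding g'_def using that q A by (subst wp_sum_raise[symmetric]) (auto simp: u)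
  have V: "(1 - q ^ Suc l) * v (Suc l) = wp_sum q (B * q) l h'" if "l \<le> n" for l
    unfolding h'_def using that q Bneq by (subst wp_sum_raise[symmetric]) (auto simp: v)
  have "h' i = c * (A * q ^ Suc n) * g' (n - i)" if "i \<le> n" for i
  proof -
    define m where "m = n - i"
    have n: "n = i + m" using that by (simp add: m_def)
    define z where "z = A * q ^ (2 * m + 1)"
    have z0: "z \<noteq> 0" using q0 A0 by (simp add: z_def)
    have z1: "1 - z \<noteq> 0" using A[of "2 * m + 1"] by (simp add: z_def n)
    have "2 * Suc n = (2 * i + 1) + (2 * m + 1)" by (simp add: n)
    then have "B * q ^ (2 * i + 1) = q ^ (2 * i + 1) / (q ^ (2 * i + 1) * z)"
      unfolding B_def z_def by (simp only: power_add) (simp add: mult_ac)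
    then have Bz: "B * q ^ (2 * i + 1) = 1 / z"
      using q0 by simp
    have e: "q ^ i * z = A * q ^ Suc n * q ^ m"
      unfolding z_def n mult_2 by (simp only: power_add power_Suc power_one_right mult_ac)
    have hi: "h i = c * g (Suc m)" "h (Suc i) = c * g m"
      using h[of i] h[of "Suc i"] by (simp_all add: n)
    have "h' i = q ^ i * (c * g (Suc m) - c * g m) / (1 - 1 / z)"
      by (simp only: h'_def hi Bz)
    also have "1 - 1 / z = - (1 - z) / z" using z0 by (simp add: field_simps)
    also have "q ^ i * (c * g (Suc m) - c * g m) / (- (1 - z) / z) = c * (q ^ i * z) * (g m - g (Suc m)) / (1 - z)"
      using z0 z1 by (simp add: divide_simps) (simp add: algebra_simps)
    finally show ?thesis
      unfolding e g'_def m_def[symmetric] unfolding z_def by (simp add: mult_ac)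
  qed
  with U V show ?thesis
    unfolding wp_dual_def Bq by blast
qed

text \<open>The weights \<open>1 - q ^ Suc l\<close> telescope to the quotient of factorials. The
  base gains a factor \<open>q\<close> whenever the length drops by one, so every step contributes
  the same constant \<open>A * q ^ (d + n)\<close>.\<close>

lemma wp_dual_raise_iter:
  fixes q A :: "'a::field"
  assumes q0: "q \<noteq> 0" and A0: "A \<noteq> 0"
    and q: "\<And>j. 1 \<le> j \<Longrightarrow> j \<le> d + n \<Longrightarrow> q ^ j \<noteq> 1"
    and A: "\<And>m. m \<le> 2 * (d + n) \<Longrightarrow> A * q ^ m \<noteq> 1"
    and dual: "wp_dual q A (d + n) c u v"
  shows "wp_dual q (A * q ^ d) n (c * (A * q ^ (d + n)) ^ d)
    (\<lambda>l. qpoch q q (d + l) / qpoch q q l * u (d + l)) (\<lambda>l. qpoch q q (d + l) / qpoch q q l * v (d + l))"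
  using assms(3-)
proof (induction d arbitrary: n)
  case 0
  have "qpoch q q l \<noteq> 0" if "l \<le> n" for l
    using 0(1) that by (intro qpoch_q_nonzero) auto
  with 0(3) show ?case by (auto elim!: wp_dual_cong)
next
  case (Suc d)
  have IH: "wp_dual q (A * q ^ d) (Suc n) (c * (A * q ^ (d + Suc n)) ^ d)
    (\<lambda>l. qpoch q q (d + l) / qpoch q q l * u (d + l)) (\<lambda>l. qpoch q q (d + l) / qpoch q q l * v (d + l))"
    using Suc.prems by (intro Suc.IH) auto
  have raise: "(1 - q ^ Suc l) * (qpoch q q (d + Suc l) / qpoch q q (Suc l) * w (d + Suc l)) =
      qpoch q q (Suc d + l) / qpoch q q l * w (Suc d + l)"
    if "l \<le> n" for l and w :: "nat \<Rightarrow> 'a"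
    using Suc.prems(1)[of "Suc l"] that by (simp add: qpoch_q_Suc del: power_Suc)
  have Aq: "A * q ^ d * q ^ m \<noteq> 1" if "m \<le> 2 * Suc n" for m
    using Suc.prems(2)[of "d + m"] that by (simp add: power_add mult.assoc)
  have qq: "q ^ j \<noteq> 1" if "1 \<le> j" "j \<le> Suc n" for j
    using Suc.prems(1)[of j] that by simp
  have "A * q ^ d \<noteq> 0" using q0 A0 by simp
  note raised = wp_dual_raise[OF q0 this qq Aq IH]
  have "wp_dual q (A * q ^ d * q) n (c * (A * q ^ (Suc d + n)) ^ Suc d)
    (\<lambda>l. qpoch q q (Suc d + l) / qpoch q q l * u (Suc d + l)) (\<lambda>l. qpoch q q (Suc d + l) / qpoch q q l * v (Suc d + l))"
  proof (rule wp_dual_cong[OF raised])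
    define X where "X = A * q ^ (Suc d + n)"
    have "A * q ^ (d + Suc n) = X" "A * q ^ d * q ^ Suc n = X"
      by (simp_all add: X_def power_add)
    then show "c * (A * q ^ (d + Suc n)) ^ d * (A * q ^ d * q ^ Suc n) = c * (A * q ^ (Suc d + n)) ^ Suc d"
      unfolding X_def[symmetric] by (simp add: mult_ac)
    fix l assume "l \<le> n"
    then show "(1 - q ^ Suc l) * (qpoch q q (d + Suc l) / qpoch q q (Suc l) * u (d + Suc l)) =
        qpoch q q (Suc d + l) / qpoch q q l * u (Suc d + l)"
      "(1 - q ^ Suc l) * (qpoch q q (d + Suc l) / qpoch q q (Suc l) * v (d + Suc l)) =
        qpoch q q (Suc d + l) / qpoch q q l * v (Suc d + l)"
      by (rule raise)+
  qed
  moreover have "A * q ^ d * q = A * q ^ Suc d" by simp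
  ultimately show ?case by (simp only:)
qed

section \<open>Summation over chains\<close>

abbreviation bounded_chains :: "nat \<Rightarrow> nat \<Rightarrow> (nat \<Rightarrow> nat) set" where
  "bounded_chains k n \<equiv> {x \<in> chains k. x k \<le> n}"

lemma chains_Suc_iff:
  assumes "k \<ge> 1"
  shows "x \<in> bounded_chains (Suc k) n \<longleftrightarrow>
    x (Suc k) \<le> n \<and> x(Suc k := undefined) \<in> bounded_chains k (x (Suc k))"
proof -
  have *: "{1..Suc k} = insert (Suc k) {1..k}" by auto
  show ?thesis
    using assms unfolding chains_def * 
    by (auto simp: PiE_iff extensional_def mono_on_def le_Suc_eq) (metis le_trans order_refl)
qed

text \<open>Peeling off the top entry gives the iterated sum on which the Bailey step acts. Chains
  are extensional, so removing an entry means resetting it to \<open>undefined\<close>.\<close>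

lemma sum_bounded_chains_Suc:
  assumes "k \<ge> 1"
  shows "(\<Sum>x\<in>bounded_chains (Suc k) n. f x) = (\<Sum>m\<le>n. \<Sum>x\<in>bounded_chains k m. f (x(Suc k := m)))"
proof -
  have ext: "x (Suc k) = undefined" if "x \<in> chains k" for x
    using that by (auto simp: chains_def PiE_iff extensional_def)
  have "(\<Sum>m\<le>n. \<Sum>x\<in>bounded_chains k m. f (x(Suc k := m))) =
      (\<Sum>(m, x)\<in>(SIGMA m:{..n}. bounded_chains k m). f (x(Suc k := m)))"
    using assms finite_bounded_chains by (subst sum.Sigma) auto
  also have "\<dots> = (\<Sum>x\<in>bounded_chains (Suc k) n. f x)"
  proof (rule sum.reindex_bij_witness[of _ "\<lambda>x. (x (Suc k), x(Suc k := undefined))" "\<lambda>(m, x). x(Suc k := m)"])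
    fix a assume "a \<in> (SIGMA m:{..n}. bounded_chains k m)"
    then show "(\<lambda>(m, x). x(Suc k := m)) a \<in> bounded_chains (Suc k) n"
      using ext[of "snd a"] assms
      by (subst chains_Suc_iff) (auto simp: fun_upd_idem)
    show "((\<lambda>(m, x). x(Suc k := m)) a (Suc k), ((\<lambda>(m, x). x(Suc k := m)) a)(Suc k := undefined)) = a"
      using ext[of "snd a"] \<open>a \<in> _\<close> by (auto simp: fun_upd_idem)
  next
    fix x assume x: "x \<in> bounded_chains (Suc k) n"
    then show "(x (Suc k), x(Suc k := undefined)) \<in> (SIGMA m:{..n}. bounded_chains k m)"
      unfolding chains_Suc_iff[OF assms] by auto
  qed auto
  finally show ?thesis by simp
qed

lemma sum_bounded_chains_1:
  "(\<Sum>x\<in>bounded_chains 1 n. f x) = (\<Sum>m\<le>n. f ((\<lambda>_. undefined)(1 := m)))"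
proof -
  have *: "(\<lambda>_. undefined)(1 := x 1) = x" if "x \<in> chains 1" for x
    using that by (auto simp: chains_def PiE_iff extensional_def)
  show ?thesis
  proof (rule sum.reindex_bij_witness[of _ "\<lambda>m. (\<lambda>_. undefined)(1 := m)" "\<lambda>x. x 1"])
    fix x assume "x \<in> bounded_chains 1 n"
    then show "(\<lambda>_. undefined)(1 := x 1) = x" "f ((\<lambda>_. undefined)(1 := x 1)) = f x"
      using *[of x] by simp_all
  qed (auto simp: chains_def PiE_iff extensional_def mono_on_def)
qed

section \<open>Recursion for the sum over \<open>r\<close> at fixed \<open>s\<close>\<close>

text \<open>The factors of the summand belonging to one index i: \<open>m\<close> is r_i,
  \<open>a\<close> and \<open>b\<close> are s_{i-1} and s_i, and \<open>n\<close> is r_{i+1}, or N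
  at the top.\<close>

definition Z_step :: "'a::field \<Rightarrow> 'a \<Rightarrow> nat \<Rightarrow> nat \<Rightarrow> nat \<Rightarrow> nat \<Rightarrow> 'a" where
  "Z_step q t a b n m =
    t powi (2 * int m - int b) * q powi ((int m)\<^sup>2 - int m * int b + (int b)\<^sup>2) *
    inv_qfact q (int n - int m) * qbinom q (int m - int a) (int m - int b)"

definition Z_inner :: "nat \<Rightarrow> nat \<Rightarrow> 'a::field \<Rightarrow> 'a \<Rightarrow> (nat \<Rightarrow> nat) \<Rightarrow> 'a" where
  "Z_inner k n t q s = (\<Sum>r\<in>bounded_chains k n. Z_term k n t q r s)"

lemma Z_inner_1:
  "Z_inner 1 n t q s =
    (\<Sum>m\<le>n. Z_step q t 0 (s 1) n m * (1 / ((qpoch (t * q) q m)\<^sup>2 * qpoch q q (s 1))))"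
  unfolding Z_inner_def sum_bounded_chains_1 by (simp add: Z_term_def Z_step_def)

text \<open>The link \<open>1 / (q;q)_{m - r_k}\<close> between the two top entries is the factor
  that \<open>Z_term k m\<close> has for its upper bound \<open>m\<close>.\<close>

lemma Z_inner_Suc:
  assumes "k \<ge> 1" "q \<noteq> 0" "t \<noteq> 0"
  shows "Z_inner (Suc k) n t q s = (\<Sum>m\<le>n. Z_step q t (s k) (s (Suc k)) n m * Z_inner k m t q s)"
proof -
  have "Z_term (Suc k) n t q (r(Suc k := m)) s = Z_step q t (s k) (s (Suc k)) n m * Z_term k m t q r s" for r m
  proof -
    define r' where "r' = r(Suc k := m)"
    have r': "r' (Suc k) = m" "\<And>i. i \<le> k \<Longrightarrow> r' i = r i" by (auto simp: r'_def)
    have range2: "{2..Suc k} = insert (Suc k) {2..k}" using assms(1) by auto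
    have p: "(\<Prod>i=2..k. inv_qfact q (int (r' i) - int (r' (i - 1)))) = (\<Prod>i=2..k. inv_qfact q (int (r i) - int (r (i - 1))))"
      by (intro prod.cong) (auto simp: r')
    have p': "(\<Prod>i=2..k. inv_qfact q (int (r i) - int (r' (i - Suc 0)))) =
        (\<Prod>i=2..k. inv_qfact q (int (r i) - int (r (i - Suc 0))))"
      by (intro prod.cong) (auto simp: r')
    have s1: "(\<Sum>i=1..k. 2 * int (r' i) - int (s i)) = (\<Sum>i=1..k. 2 * int (r i) - int (s i))"
      by (intro sum.cong) (auto simp: r')
    have s2: "(\<Sum>i=1..k. (int (r' i))\<^sup>2 - int (r' i) * int (s i) + (int (s i))\<^sup>2) =
        (\<Sum>i=1..k. (int (r i))\<^sup>2 - int (r i) * int (s i) + (int (s i))\<^sup>2)"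
      by (intro sum.cong) (auto simp: r')
    have p2: "(\<Prod>i=1..k. qbinom q (int (r' i) - int ((s(0 := 0)) (i - 1))) (int (r' i) - int (s i))) =
        (\<Prod>i=1..k. qbinom q (int (r i) - int ((s(0 := 0)) (i - 1))) (int (r i) - int (s i)))"
      by (intro prod.cong) (auto simp: r')
    have sk: "(s(0 := 0)) k = s k" using assms(1) by simp
    show ?thesis
      using assms unfolding r'_def[symmetric] Z_term_def Z_step_def range2
      by (simp add: r' p p' s1 s2 p2 sk power_int_add del: fun_upd_apply)
  qed
  then show ?thesis
    unfolding Z_inner_def sum_bounded_chains_Suc[OF assms(1)] by (simp add: sum_distrib_left)
qed

lemma Z_sum_eq_Z_inner:
  "Z_sum k N t q = (\<Sum>s\<in>bounded_chains k N. Z_inner k N t q s)"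
  unfolding Z_sum_def Z_inner_def by (subst sum.swap) (simp add: sum.cartesian_product)

lemma Z_step_eq_0: "m < b \<Longrightarrow> Z_step q t a b n m = 0"
  by (simp add: Z_step_def qbinom_def)

text \<open>Since \<open>(b + j)^2 - (b + j) b + b^2 = b^2 + b j + j^2\<close>, the step is a
  constant times the Bailey weight for the base \<open>t\<^sup>2 * q ^ b\<close> times the weight of
  \<open>b - a\<close> raises, which comes from the q-binomial.\<close>

lemma Z_step_shift:
  fixes q t :: "'a::field"
  assumes "a \<le> b" "j \<le> l" "q \<noteq> 0" "t \<noteq> 0"
  shows "Z_step q t a b (b + l) (b + j) = t ^ b * q ^ b\<^sup>2 / qpoch q q (b - a) *
    ((t\<^sup>2 * q ^ b) ^ j * q ^ j\<^sup>2 / qpoch q q (l - j) * (qpoch q q (b - a + j) / qpoch q q j))"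
proof -
  have e1: "2 * int (b + j) - int b = int (b + 2 * j)" by simp
  have e2: "(int (b + j))\<^sup>2 - int (b + j) * int b + (int b)\<^sup>2 = int (b\<^sup>2 + b * j + j\<^sup>2)"
    by (simp add: power2_eq_square algebra_simps)
  have e3: "int (b + l) - int (b + j) = int (l - j)" using assms(2) by simp
  have e4: "int (b + j) - int a = int (b - a + j)" using assms(1) by simp
  have e5: "int (b + j) - int b = int j" by simp
  have e6: "int (b - a + j) - int j = int (b - a)" using assms(1) by simp
  have pow: "t ^ (b + 2 * j) * q ^ (b\<^sup>2 + b * j + j\<^sup>2) = t ^ b * q ^ b\<^sup>2 * ((t\<^sup>2 * q ^ b) ^ j * q ^ j\<^sup>2)"
    unfolding power_add power_mult power_mult_distrib by (simp only: mult_ac)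
  show ?thesis
    unfolding Z_step_def e1 e2 e3 e4 e5 power_int_of_nat pow inv_qfact_def qbinom_def e6 nat_int
    by (simp add: mult_ac)
qed

section \<open>The reflection carried along a chain\<close>

text \<open>One step consists of \<open>d = b - a\<close> raises, a Bailey step and a rescaling.
  With \<open>y = t\<^sup>2 * q ^ N\<close> they change the constant by \<open>y ^ d\<close>,
  \<open>1 / y ^ n\<close> and \<open>1 / y ^ b\<close>, where \<open>n + b = N\<close>.\<close>

lemma wp_dual_Z_step:
  fixes q t :: "'a::field"
  assumes q0: "q \<noteq> 0" and t0: "t \<noteq> 0"
    and q: "\<And>j. 1 \<le> j \<Longrightarrow> j \<le> N \<Longrightarrow> q ^ j \<noteq> 1"
    and t2: "\<And>m. m \<le> 2 * N \<Longrightarrow> t\<^sup>2 * q ^ m \<noteq> 1"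
    and ab: "a \<le> b" "b \<le> N"
    and t': "t' = 1 / (t * q ^ N)"
    and dual: "wp_dual q (t\<^sup>2 * q ^ a) (N - a) c (\<lambda>l. U (a + l)) (\<lambda>l. U' (a + l))"
  shows "wp_dual q (t\<^sup>2 * q ^ b) (N - b) (c * (t\<^sup>2 * q ^ N) ^ (b - a) / (t\<^sup>2 * q ^ N) ^ N)
    (\<lambda>l. \<Sum>m\<le>b + l. Z_step q t a b (b + l) m * U m)
    (\<lambda>l. \<Sum>m\<le>b + l. Z_step q t' a b (b + l) m * U' m)"
proof -
  define d n A B where "d = b - a" and "n = N - b" and "A = t\<^sup>2 * q ^ b" and "B = t'\<^sup>2 * q ^ b"
  define y where "y = t\<^sup>2 * q ^ N"
  define \<kappa> where "\<kappa> = (\<lambda>t. t ^ b * q ^ b\<^sup>2 / qpoch q q d)"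
  define u where "u = (\<lambda>l. qpoch q q (d + l) / qpoch q q l * U (b + l))"
  define u' where "u' = (\<lambda>l. qpoch q q (d + l) / qpoch q q l * U' (b + l))"
  have N: "N = b + n" and b: "b = a + d" using ab by (simp_all add: d_def n_def)
  have y0: "y \<noteq> 0" using q0 t0 by (simp add: y_def)
  have t'0: "t' \<noteq> 0" using q0 t0 by (simp add: t')
  have qd: "qpoch q q d \<noteq> 0" by (rule qpoch_q_nonzero[of N]) (use q in \<open>auto simp: N b\<close>)
  have dual': "wp_dual q (t\<^sup>2 * q ^ a) (d + n) c (\<lambda>l. U (a + l)) (\<lambda>l. U' (a + l))"
    using dual by (simp add: N b add.assoc)
  have "wp_dual q (t\<^sup>2 * q ^ a * q ^ d) n (c * (t\<^sup>2 * q ^ a * q ^ (d + n)) ^ d)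
      (\<lambda>l. qpoch q q (d + l) / qpoch q q l * U (a + (d + l)))
      (\<lambda>l. qpoch q q (d + l) / qpoch q q l * U' (a + (d + l)))"
  proof (rule wp_dual_raise_iter[OF q0 _ _ _ dual'])
    show "t\<^sup>2 * q ^ a * q ^ m \<noteq> 1" if "m \<le> 2 * (d + n)" for m
      using t2[of "a + m"] that by (simp add: N b power_add mult.assoc)
  qed (use q q0 t0 in \<open>auto simp: N b\<close>)
  moreover have "t\<^sup>2 * q ^ a * q ^ d = A" "t\<^sup>2 * q ^ a * q ^ (d + n) = y" "\<And>l. a + (d + l) = b + l"
    by (simp_all add: A_def y_def N b power_add mult.assoc add.assoc)
  ultimately have raised: "wp_dual q A n (c * y ^ d) u u'"
    unfolding u_def u'_def by (simp only:)
  have A0: "A \<noteq> 0" using q0 t0 by (simp add: A_def)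
  \<comment> \<open>Replacing \<open>t\<close> by \<open>t'\<close> is the reflection of the base,
    whatever \<open>b\<close> is.\<close>
  have B: "B = 1 / (A * q ^ (2 * n))"
  proof -
    have "t'\<^sup>2 * (A * q ^ (2 * n)) * q ^ b = t'\<^sup>2 * (t * q ^ N)\<^sup>2"
      by (simp add: A_def N power_mult_distrib power_add mult_ac power2_eq_square mult_2_right mult_2)
    also have "\<dots> = 1" using q0 t0 by (simp add: t' power_one_over)
    finally have "B * (A * q ^ (2 * n)) = 1" by (simp add: B_def mult_ac)
    then show ?thesis using q0 A0 by (simp add: eq_divide_eq)
  qed
  have AN: "A * q ^ m \<noteq> 1" if "m \<le> 2 * n" for m
    using t2[of "b + m"] that by (simp add: A_def N power_add mult.assoc)
  have qn: "q ^ j \<noteq> 1" if "1 \<le> j" "j \<le> n" for j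
    using q that by (simp add: N)
  have k0: "\<kappa> t \<noteq> 0" using q0 t0 qd by (simp add: \<kappa>_def)
  \<comment> \<open>Here \<open>t\<close> is bound anew: the formula is used at \<open>t\<close> and
    at \<open>t'\<close>.\<close>
  have sum_shift: "(\<Sum>m\<le>b + l. Z_step q t a b (b + l) m * V m) =
      \<kappa> t * (\<Sum>m\<le>l. (t\<^sup>2 * q ^ b) ^ m * q ^ m\<^sup>2 / qpoch q q (l - m) * (qpoch q q (d + m) / qpoch q q m * V (b + m)))"
    if "t \<noteq> 0" for t :: 'a and V l
  proof -
    have "(\<Sum>m\<le>b + l. Z_step q t a b (b + l) m * V m) = (\<Sum>m\<in>{b..b + l}. Z_step q t a b (b + l) m * V m)"
      by (intro sum.mono_neutral_right) (auto simp: Z_step_eq_0)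
    also have "\<dots> = (\<Sum>m\<le>l. Z_step q t a b (b + l) (b + m) * V (b + m))"
      by (rule sum.reindex_bij_witness[of _ "\<lambda>m. b + m" "\<lambda>m. m - b"]) auto
    also have "\<dots> = (\<Sum>m\<le>l. \<kappa> t * ((t\<^sup>2 * q ^ b) ^ m * q ^ m\<^sup>2 / qpoch q q (l - m) *
        (qpoch q q (d + m) / qpoch q q m * V (b + m))))"
      using ab(1) q0 that by (intro sum.cong refl) (simp add: Z_step_shift \<kappa>_def d_def)
    finally show ?thesis by (simp add: sum_distrib_left)
  qed
  have ratio: "c * y ^ d / (A ^ n * q ^ n\<^sup>2) * \<kappa> t' / \<kappa> t = c * y ^ d / y ^ N"
  proof -
    have "A ^ n * q ^ n\<^sup>2 = y ^ n"
      by (simp add: A_def y_def N power_mult_distrib power_add power2_eq_square mult_ac flip: power_mult)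
    moreover have "\<kappa> t' / \<kappa> t = (t' / t) ^ b"
      using q0 qd by (simp add: \<kappa>_def power_divide)
    moreover have "t' / t = 1 / y"
      using q0 t0 by (simp add: t' y_def power2_eq_square mult_ac)
    ultimately have "c * y ^ d / (A ^ n * q ^ n\<^sup>2) * (\<kappa> t' / \<kappa> t) = c * y ^ d / (y ^ n * y ^ b)"
      by (simp add: power_one_over)
    then show ?thesis by (simp add: N power_add mult_ac)
  qed
  from wp_dual_scale[OF k0 wp_dual_bailey[OF q0 A0 qn AN raised B], where \<kappa>' = "\<kappa> t'"]
  show ?thesis
    unfolding ratio
    unfolding sum_shift[OF t0] sum_shift[OF t'0] u_def u'_def A_def B_def y_def d_def n_def
    by simp
qed

text \<open>Over the \<open>k\<close> steps the exponents s_i - s_{i-1} telescope to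
  \<open>s k\<close>, and each step divides by \<open>(t\<^sup>2 * q ^ N) ^ N\<close>. The first
  fraction comes from the starting value.\<close>

lemma wp_dual_Z_inner:
  fixes q t :: "'a::field"
  assumes q0: "q \<noteq> 0" and t0: "t \<noteq> 0"
    and q: "\<And>j. 1 \<le> j \<Longrightarrow> j \<le> N \<Longrightarrow> q ^ j \<noteq> 1"
    and t: "\<And>j. j \<le> N \<Longrightarrow> t * q ^ j \<noteq> 1"
    and t2: "\<And>m. m \<le> 2 * N \<Longrightarrow> t\<^sup>2 * q ^ m \<noteq> 1"
    and t': "t' = 1 / (t * q ^ N)"
    and "k \<ge> 1" and "s k \<le> N" and "\<And>i. 1 \<le> i \<Longrightarrow> i < k \<Longrightarrow> s i \<le> s (Suc i)"
  shows "wp_dual q (t\<^sup>2 * q ^ s k) (N - s k)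
    ((1 - t * q ^ N)\<^sup>2 / ((1 - t)\<^sup>2 * q ^ N) * (t\<^sup>2 * q ^ N) ^ s k / ((t\<^sup>2 * q ^ N) ^ N) ^ k)
    (\<lambda>l. Z_inner k (s k + l) t q s) (\<lambda>l. Z_inner k (s k + l) t' q s)"
  using assms(7-)
proof (induction k rule: dec_induct)
  case base
  define c where "c = (1 - t * q ^ N)\<^sup>2 / ((1 - t)\<^sup>2 * q ^ N)"
  define p where "p = qpoch q q (s 1)"
  have t'0: "t' \<noteq> 0" using q0 t0 by (simp add: t')
  have t'_pow: "t' * q ^ i = 1 / (t * q ^ (N - i))" if "i \<le> N" for i
  proof -
    have "q ^ N = q ^ (N - i) * q ^ i" using that by (simp flip: power_add)
    then show ?thesis using q0 by (simp add: t')
  qed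
  have t'n: "t' * q ^ j \<noteq> 1" if "j \<le> N" for j
    using t[of "N - j"] q0 t0 by (simp add: t'_pow that)
  have t'2: "t'\<^sup>2 = 1 / (t\<^sup>2 * q ^ 0 * q ^ (2 * N))"
    by (simp add: t' power_one_over power_mult_distrib power_mult mult.commute[of 2])
  have t2n: "t\<^sup>2 * q ^ 0 * q ^ m \<noteq> 1" if "m \<le> 2 * N" for m
    using t2 that by simp
  have t'2n: "t'\<^sup>2 * q ^ m \<noteq> 1" if "m \<le> 2 * N" for m
    unfolding t'2 using q0 _ t2n that by (rule wp_dual_base_neq) (use q0 t0 in auto)
  \<comment> \<open>The factor \<open>(1 - x)\<^sup>2\<close> removes the first factor of
    \<open>(x;q)_{l+1}\<close> in \<open>wp_sum_square\<close>.\<close>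
  have sq: "1 / ((qpoch (x * q) q l)\<^sup>2 * p) = wp_sum q (x\<^sup>2) l (\<lambda>i. (1 - x)\<^sup>2 / p * (q ^ i / (1 - x * q ^ i)\<^sup>2))"
    if "l \<le> N" and x: "\<And>j. j \<le> N \<Longrightarrow> x * q ^ j \<noteq> 1" "\<And>m. m \<le> 2 * N \<Longrightarrow> x\<^sup>2 * q ^ m \<noteq> 1" for x l
  proof -
    have "wp_sum q (x\<^sup>2) l (\<lambda>i. q ^ i / (1 - x * q ^ i)\<^sup>2) = 1 / (qpoch x q (Suc l))\<^sup>2"
      using that q by (intro wp_sum_square) auto
    moreover have "1 - x \<noteq> 0" using x(1)[of 0] by simp
    ultimately show ?thesis
      unfolding wp_sum_scale by (simp add: qpoch_Suc_shift power_mult_distrib)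
  qed
  \<comment> \<open>Reversal sends \<open>x = t * q ^ (N - i)\<close> to \<open>1 / x\<close>, and
    \<open>x / (1 - x)^2\<close> is invariant under this inversion.\<close>
  have dual: "(1 - t')\<^sup>2 / p * (q ^ i / (1 - t' * q ^ i)\<^sup>2) = c * ((1 - t)\<^sup>2 / p * (q ^ (N - i) / (1 - t * q ^ (N - i))\<^sup>2))"
    if "i \<le> N" for i
  proof -
    define x where "x = t * q ^ (N - i)"
    have x0: "x \<noteq> 0" using q0 t0 by (simp add: x_def)
    have t1: "1 - t \<noteq> 0" using t[of 0] by simp
    have qN: "q ^ N = q ^ (N - i) * q ^ i" using that by (simp flip: power_add)
    have "1 - t' * q ^ i = - (1 - x) / x"
      unfolding t'_pow[OF that] x_def[symmetric] using x0 by (simp add: field_simps)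
    then have 1: "(1 - t' * q ^ i)\<^sup>2 = (1 - x)\<^sup>2 / x\<^sup>2" by (simp add: power_divide power2_commute)
    have "1 - t' = - (1 - t * q ^ N) / (t * q ^ N)"
      using q0 t0 by (simp add: t' field_simps)
    then have 2: "(1 - t')\<^sup>2 = (1 - t * q ^ N)\<^sup>2 / (t * q ^ N)\<^sup>2" by (simp add: power_divide power2_commute)
    have 3: "q ^ i * x\<^sup>2 / (t * q ^ N)\<^sup>2 = q ^ (N - i) / q ^ N"
      using q0 t0 unfolding x_def qN by (simp add: power2_eq_square field_simps)
    have "(1 - t')\<^sup>2 / p * (q ^ i / (1 - t' * q ^ i)\<^sup>2) =
        (1 - t * q ^ N)\<^sup>2 / p * (q ^ i * x\<^sup>2 / (t * q ^ N)\<^sup>2) / (1 - x)\<^sup>2"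
      unfolding 1 2 by simp
    also have "\<dots> = c * ((1 - t)\<^sup>2 / p * (q ^ (N - i) / (1 - x)\<^sup>2))"
      unfolding 3 c_def using t1 by simp
    finally show ?thesis by (simp only: x_def)
  qed
  \<comment> \<open>The zeros are left unsimplified to match \<open>wp_dual_Z_step\<close> at
    \<open>a = 0\<close>, the convention s_0 = 0.\<close>
  have "wp_dual q (t\<^sup>2 * q ^ 0) (N - 0) c
      (\<lambda>l. 1 / ((qpoch (t * q) q (0 + l))\<^sup>2 * p)) (\<lambda>l. 1 / ((qpoch (t' * q) q (0 + l))\<^sup>2 * p))"
    unfolding wp_dual_def diff_zero t'2[symmetric]
    by (rule exI[of _ "\<lambda>i. (1 - t)\<^sup>2 / p * (q ^ i / (1 - t * q ^ i)\<^sup>2)"],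
        rule exI[of _ "\<lambda>i. (1 - t')\<^sup>2 / p * (q ^ i / (1 - t' * q ^ i)\<^sup>2)"])
      (use t t2 t'n t'2n sq dual in simp)
  from wp_dual_Z_step[OF q0 t0 q t2 _ base(1) t' this]
  show ?case
    unfolding Z_inner_1 p_def c_def by simp
next
  case (step k)
  have IH: "wp_dual q (t\<^sup>2 * q ^ s k) (N - s k)
    ((1 - t * q ^ N)\<^sup>2 / ((1 - t)\<^sup>2 * q ^ N) * (t\<^sup>2 * q ^ N) ^ s k / ((t\<^sup>2 * q ^ N) ^ N) ^ k)
    (\<lambda>l. Z_inner k (s k + l) t q s) (\<lambda>l. Z_inner k (s k + l) t' q s)"
    using step.prems(1) step.prems(2)[of k] step.prems(2) step.hyps(1) by (intro step.IH) fastforce+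
  have le: "s k \<le> s (Suc k)" using step.prems(2)[of k] step.hyps by simp
  have t'0: "t' \<noteq> 0" using q0 t0 by (simp add: t')
  have c: "C * y ^ s k / (y ^ N) ^ k * y ^ (s (Suc k) - s k) / y ^ N = C * y ^ s (Suc k) / (y ^ N) ^ Suc k" for C y :: 'a
  proof -
    have "y ^ s (Suc k) = y ^ s k * y ^ (s (Suc k) - s k)" using le by (simp flip: power_add)
    then show ?thesis by (simp add: mult_ac)
  qed
  from wp_dual_Z_step[OF q0 t0 q t2 le step.prems(1) t' IH]
  show ?case
    unfolding c Z_inner_Suc[OF step.hyps(1) q0 t0] Z_inner_Suc[OF step.hyps(1) q0 t'0] .
qed

text \<open>The duality constant contributes \<open>y ^ s k\<close> and the final reversal
  \<open>y ^ (N - s k)\<close>. Their product does not depend on \<open>s\<close>, so the factor can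
  be taken out of the sum over \<open>s\<close>.\<close>

lemma Z_sum_reflection_generic:
  fixes q t :: "'a::field"
  assumes "k \<ge> 1" and q0: "q \<noteq> 0" and t0: "t \<noteq> 0"
    and q: "\<And>j. 1 \<le> j \<Longrightarrow> j \<le> N \<Longrightarrow> q ^ j \<noteq> 1"
    and t: "\<And>j. j \<le> N \<Longrightarrow> t * q ^ j \<noteq> 1"
    and t2: "\<And>m. m \<le> 2 * N \<Longrightarrow> t\<^sup>2 * q ^ m \<noteq> 1"
  shows "Z_sum k N t q =
    (1 - t)\<^sup>2 * q ^ N * (t ^ (2 * N) * q ^ N\<^sup>2) ^ (k - 1) / (1 - t * q ^ N)\<^sup>2 *
    Z_sum k N (inverse t * inverse (q ^ N)) q"
proof -
  define t' where "t' = 1 / (t * q ^ N)"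
  define y where "y = t\<^sup>2 * q ^ N"
  define c where "c = (1 - t * q ^ N)\<^sup>2 / ((1 - t)\<^sup>2 * q ^ N)"
  have y0: "y \<noteq> 0" using q0 t0 by (simp add: y_def)
  have c0: "c \<noteq> 0" using q0 t[of 0] t[of N] by (simp add: c_def)
  have yN: "y ^ N = t ^ (2 * N) * q ^ N\<^sup>2"
    by (simp add: y_def power_mult_distrib power2_eq_square mult_2 power_add flip: power_mult)
  have "Z_inner k N t' q s = c / (y ^ N) ^ (k - 1) * Z_inner k N t q s"
    if s: "s \<in> bounded_chains k N" for s
  proof -
    define n where "n = N - s k"
    have N: "N = s k + n" using s by (simp add: n_def)
    have A0: "t\<^sup>2 * q ^ s k \<noteq> 0" using q0 t0 by simp
    have "s i \<le> s (Suc i)" if "1 \<le> i" "i < k" for i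
      using s that by (auto simp: chains_def mono_on_def)
    with s assms(1) have dual: "wp_dual q (t\<^sup>2 * q ^ s k) n (c * y ^ s k / (y ^ N) ^ k)
        (\<lambda>l. Z_inner k (s k + l) t q s) (\<lambda>l. Z_inner k (s k + l) t' q s)"
      unfolding c_def y_def n_def
      by (intro wp_dual_Z_inner[OF q0 t0 q t t2 t'_def]) auto
    have yn: "(t\<^sup>2 * q ^ s k) ^ n * q ^ n\<^sup>2 = y ^ n"
      by (simp add: y_def N power_mult_distrib power_add power2_eq_square mult_ac flip: power_mult)
    have "Z_inner k N t' q s = c * y ^ s k / (y ^ N) ^ k * ((t\<^sup>2 * q ^ s k) ^ n * q ^ n\<^sup>2) * Z_inner k N t q s"
      using wp_dual_last[OF q0 A0 dual] by (simp add: N mult.assoc)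
    also have "c * y ^ s k / (y ^ N) ^ k * ((t\<^sup>2 * q ^ s k) ^ n * q ^ n\<^sup>2) = c * y ^ N / (y ^ N) ^ k"
      unfolding yn by (simp add: N power_add)
    also have "\<dots> = c / (y ^ N) ^ (k - 1)"
      using y0 assms(1) by (cases k) simp_all
    finally show ?thesis .
  qed
  then have "Z_sum k N t' q = c / (y ^ N) ^ (k - 1) * Z_sum k N t q"
    unfolding Z_sum_eq_Z_inner sum_distrib_left by (intro sum.cong refl)
  then have "Z_sum k N t q = (y ^ N) ^ (k - 1) / c * Z_sum k N t' q"
    using y0 c0 by simp
  then show ?thesis
    unfolding yN c_def t'_def by (simp add: divide_inverse mult_ac)
qed

section \<open>Removing the genericity assumption\<close>

text \<open>A single quotient serves all of \<open>E\<close>, with a denominator free of zeros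
  there, so that agreement at infinitely many points of \<open>E\<close> spreads to every point of
  \<open>E\<close>.\<close>

definition rational_on :: "'a::field set \<Rightarrow> ('a \<Rightarrow> 'a) \<Rightarrow> bool" where
  "rational_on E f \<longleftrightarrow> (\<exists>p d. \<forall>x\<in>E. poly d x \<noteq> 0 \<and> f x = poly p x / poly d x)"

lemma rational_on_const [intro]: "rational_on E (\<lambda>_. c)"
  unfolding rational_on_def by (intro exI[of _ "[:c:]"] exI[of _ 1]) simp

lemma rational_on_id [intro]: "rational_on E (\<lambda>x. x)"
  unfolding rational_on_def by (intro exI[of _ "[:0, 1:]"] exI[of _ 1]) simp

lemma rational_on_add [intro]:
  assumes "rational_on E f" "rational_on E g"
  shows "rational_on E (\<lambda>x. f x + g x)"
proof -
  from assms obtain p d p' d' where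
    "\<forall>x\<in>E. poly d x \<noteq> 0 \<and> f x = poly p x / poly d x" "\<forall>x\<in>E. poly d' x \<noteq> 0 \<and> g x = poly p' x / poly d' x"
    unfolding rational_on_def by blast
  then show ?thesis unfolding rational_on_def
    by (intro exI[of _ "p * d' + p' * d"] exI[of _ "d * d'"]) (simp add: add_frac_eq)
qed

lemma rational_on_mult [intro]:
  assumes "rational_on E f" "rational_on E g"
  shows "rational_on E (\<lambda>x. f x * g x)"
proof -
  from assms obtain p d p' d' where
    "\<forall>x\<in>E. poly d x \<noteq> 0 \<and> f x = poly p x / poly d x" "\<forall>x\<in>E. poly d' x \<noteq> 0 \<and> g x = poly p' x / poly d' x"
    unfolding rational_on_def by blast
  then show ?thesis unfolding rational_on_def
    by (intro exI[of _ "p * p'"] exI[of _ "d * d'"]) simp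
qed

lemma rational_on_inverse [intro]:
  assumes "rational_on E f" "\<And>x. x \<in> E \<Longrightarrow> f x \<noteq> 0"
  shows "rational_on E (\<lambda>x. inverse (f x))"
proof -
  from assms(1) obtain p d where "\<forall>x\<in>E. poly d x \<noteq> 0 \<and> f x = poly p x / poly d x"
    unfolding rational_on_def by blast
  with assms(2) show ?thesis unfolding rational_on_def
    by (intro exI[of _ d] exI[of _ p]) fastforce
qed

lemma rational_on_diff [intro]:
  assumes "rational_on E f" "rational_on E g"
  shows "rational_on E (\<lambda>x. f x - g x)"
  using rational_on_add[OF assms(1) rational_on_mult[OF rational_on_const[of E "-1"] assms(2)]] by simp

lemma rational_on_divide [intro]:
  assumes "rational_on E f" "rational_on E g" "\<And>x. x \<in> E \<Longrightarrow> g x \<noteq> 0"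
  shows "rational_on E (\<lambda>x. f x / g x)"
  unfolding divide_inverse by (intro rational_on_mult rational_on_inverse assms)

lemma rational_on_power [intro]: "rational_on E f \<Longrightarrow> rational_on E (\<lambda>x. f x ^ n)"
  by (induction n) auto

lemma rational_on_power_int:
  assumes "rational_on E f" "\<And>x. x \<in> E \<Longrightarrow> f x \<noteq> 0"
  shows "rational_on E (\<lambda>x. f x powi n)"
proof (cases "n \<ge> 0")
  case True
  then show ?thesis using assms(1) by (simp add: power_int_def rational_on_power)
next
  case False
  then show ?thesis
    using rational_on_power[OF rational_on_inverse[OF assms]] by (simp add: power_int_def)
qed

lemma rational_on_sum [intro]: "(\<And>i. i \<in> I \<Longrightarrow> rational_on E (f i)) \<Longrightarrow> rational_on E (\<lambda>x. \<Sum>i\<in>I. f i x)"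
  by (induction I rule: infinite_finite_induct) auto

lemma rational_on_prod [intro]: "(\<And>i. i \<in> I \<Longrightarrow> rational_on E (f i)) \<Longrightarrow> rational_on E (\<lambda>x. \<Prod>i\<in>I. f i x)"
  by (induction I rule: infinite_finite_induct) auto

text \<open>The cross-multiplied difference of the two quotients is a polynomial with infinitely
  many roots.\<close>

lemma rational_on_eq_of_cofinite:
  assumes "rational_on E f" "rational_on E g" "infinite E" "finite F"
    and "\<And>x. x \<in> E - F \<Longrightarrow> f x = g x" and "x \<in> E"
  shows "f x = g x"
proof -
  from assms(1,2) obtain p d p' d' where
    f: "\<And>x. x \<in> E \<Longrightarrow> poly d x \<noteq> 0 \<and> f x = poly p x / poly d x" and
    g: "\<And>x. x \<in> E \<Longrightarrow> poly d' x \<noteq> 0 \<and> g x = poly p' x / poly d' x"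
    unfolding rational_on_def by metis
  define h where "h = p * d' - p' * d"
  have h: "poly h x = 0 \<longleftrightarrow> f x = g x" if "x \<in> E" for x
    using f[OF that] g[OF that] by (simp add: h_def frac_eq_eq)
  have "E - F \<subseteq> {x. poly h x = 0}" using h assms(5) by auto
  moreover have "infinite (E - F)" using assms(3,4) by simp
  ultimately have "h = 0" using poly_roots_finite[of h] finite_subset by blast
  with h[OF assms(6)] show ?thesis by simp
qed

text \<open>Stated for a rational argument \<open>f\<close>, as it is applied to \<open>t\<close>
  itself and to \<open>1 / (t q^N)\<close>. The exponent of \<open>f x\<close> may be negative,
  hence \<open>f x\<close> must not vanish.\<close>

lemma rational_on_Z_sum:
  fixes q :: "'a::field"
  assumes "k \<ge> 1" and q: "\<And>j. 1 \<le> j \<Longrightarrow> j \<le> N \<Longrightarrow> q ^ j \<noteq> 1"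
    and f: "rational_on E f" "\<And>x. x \<in> E \<Longrightarrow> f x \<noteq> 0"
    and fq: "\<And>x j. x \<in> E \<Longrightarrow> 1 \<le> j \<Longrightarrow> j \<le> N \<Longrightarrow> f x * q ^ j \<noteq> 1"
  shows "rational_on E (\<lambda>x. Z_sum k N (f x) q)"
proof -
  have le: "r 1 \<le> N" if "r \<in> bounded_chains k N" for r
  proof -
    have "r 1 \<le> r k" using that assms(1) by (auto simp: chains_def mono_on_def)
    with that show ?thesis by auto
  qed
  have "rational_on E (\<lambda>x. Z_term k N (f x) q r s)"
    if r: "r \<in> bounded_chains k N" and s: "s \<in> bounded_chains k N" for r s
    unfolding Z_term_def
  proof (intro rational_on_mult rational_on_const rational_on_divide rational_on_power_int f rational_on_power)
    show "rational_on E (\<lambda>x. qpoch (f x * q) q (r 1))"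
      unfolding qpoch_def using f(1) by (intro rational_on_prod rational_on_diff rational_on_mult) auto
    fix x assume x: "x \<in> E"
    have "qpoch (f x * q) q (r 1) \<noteq> 0"
      using fq[OF x, of "Suc j" for j] le[OF r] by (auto simp: qpoch_eq_0_iff mult.assoc)
    moreover have "qpoch q q (s 1) \<noteq> 0"
      by (rule qpoch_q_nonzero[of N]) (use q le[OF s] in auto)
    ultimately show "(qpoch (f x * q) q (r 1))\<^sup>2 * qpoch q q (s 1) \<noteq> 0" by simp
  qed
  then show ?thesis
    unfolding Z_sum_def case_prod_unfold by (intro rational_on_sum) auto
qed

theorem theorem1p8:
  fixes q t :: "'a::field_char_0" and k N :: nat
  assumes "k \<ge> 1"
    and "q \<noteq> 0" and "t \<noteq> 0"
    and "\<And>j. 1 \<le> j \<Longrightarrow> j \<le> N \<Longrightarrow> q ^ j \<noteq> 1"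
    and "\<And>j. j \<le> N \<Longrightarrow> t * q ^ j \<noteq> 1"
  shows "Z_sum k N t q =
    (1 - t)\<^sup>2 * q ^ N * (t ^ (2 * N) * q ^ (N\<^sup>2)) ^ (k - 1) / (1 - t * q ^ N)\<^sup>2 *
    Z_sum k N (inverse t * inverse (q ^ N)) q"
proof -
  \<comment> \<open>The exponents \<open>1..N\<close> exclude the poles of the left-hand sum and, by
    \<open>j -> N - j\<close>, the exponents \<open>0..N - 1\<close> those of the right-hand sum;
    \<open>j = N\<close> also covers the prefactor.\<close>
  define E where "E = {t. t \<noteq> 0 \<and> (\<forall>j\<le>N. t * q ^ j \<noteq> 1)}"
  \<comment> \<open>The poles of the intermediate very-well-poised sums, at which the generic case
    says nothing.\<close>
  define F where "F = (\<Union>m\<le>2 * N. {t. t\<^sup>2 * q ^ m = 1})"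
  have "finite {t. t\<^sup>2 * q ^ m = 1}" for m
  proof -
    have "{t. t\<^sup>2 * q ^ m = 1} = {t. poly [:-1, 0, q ^ m:] t = 0}"
      by (auto simp: power2_eq_square algebra_simps)
    then show ?thesis using poly_roots_finite[of "[:-1, 0, q ^ m:]"] by simp
  qed
  then have "finite F" by (simp add: F_def)
  have "- E \<subseteq> insert 0 ((\<lambda>j. 1 / q ^ j) ` {..N})"
    using assms(2) by (auto simp: E_def field_simps)
  then have "finite (- E)" by (rule finite_subset) simp
  \<comment> \<open>A field of characteristic 0 is infinite, and \<open>E\<close> omits finitely
    many points.\<close>
  then have "infinite E"
    using infinite_UNIV_char_0[where 'a = 'a] by (metis finite_Un Compl_partition)
  show ?thesis
  proof (rule rational_on_eq_of_cofinite[of E _ _ F t])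
    show "rational_on E (\<lambda>t. Z_sum k N t q)"
      using assms(1,4) by (intro rational_on_Z_sum) (auto simp: E_def)
    have neq: "inverse t * inverse (q ^ N) * q ^ j \<noteq> 1" if "t \<in> E" "j \<le> N" for t j
    proof -
      have "q ^ N = q ^ (N - j) * q ^ j" using that(2) by (simp flip: power_add)
      then have "inverse t * inverse (q ^ N) * q ^ j = inverse (t * q ^ (N - j))"
        using assms(2) by simp
      moreover have "t * q ^ (N - j) \<noteq> 1" using that(1) by (simp add: E_def)
      ultimately show ?thesis by (metis inverse_eq_1_iff)
    qed
    show "rational_on E (\<lambda>t. (1 - t)\<^sup>2 * q ^ N * (t ^ (2 * N) * q ^ (N\<^sup>2)) ^ (k - 1) / (1 - t * q ^ N)\<^sup>2 *
        Z_sum k N (inverse t * inverse (q ^ N)) q)"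
      using assms(1,2,4) neq
      by (intro rational_on_mult rational_on_divide rational_on_power rational_on_diff rational_on_const
          rational_on_id rational_on_Z_sum rational_on_inverse) (auto simp: E_def)
    show "Z_sum k N t q =
        (1 - t)\<^sup>2 * q ^ N * (t ^ (2 * N) * q ^ (N\<^sup>2)) ^ (k - 1) / (1 - t * q ^ N)\<^sup>2 *
        Z_sum k N (inverse t * inverse (q ^ N)) q" if "t \<in> E - F" for t
      using assms(1,2,4) that by (intro Z_sum_reflection_generic) (auto simp: E_def F_def)
    show "t \<in> E" using assms(3,5) by (simp add: E_def)
  qed fact+
qed

end
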